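(* Let $k$ be a field of characteristic zero. The differential algebra $D_2 = k_{+}\{x\}/[x^2]$ is prime, i.e. for any two nonzero differential ideals $A,B$ of $D_2$ one has $AB\neq 0$.
   Context: $k\{x\}$ denotes the differential polynomial algebra in one indeterminate: the polynomial algebra $k[x_0,x_1,x_2,\dots]$ (with $x = x_0$) with the $k$-linear derivation satisfying $x_n' = x_{n+1}$. $k_{+}\{x\}$ is its subalgebra (without unity) of differential polynomials with zero constant term. A differential ideal is an ideal $I$ with $I'\subseteq I$; $[x^2]$ denotes the differential ideal of $k_{+}\{x\}$ generated by $x^2$, and $D_2$ carries the induced derivation. *)

theory Defs
  imports "HOL-Library.Poly_Mapping"
begin

(* Differential polynomials k{x} = k[x_0,x_1,...]: polynomials in countably many
variables x_n, represented as finitely supported maps from monomials (exponent vectors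
nat-indexed, finitely supported) to coefficients.*)

type_synonym 'k dpoly = "(nat \<Rightarrow>\<^sub>0 nat) \<Rightarrow>\<^sub>0 'k"

definition var :: "nat \<Rightarrow> 'k::comm_ring_1 dpoly" where
  "var n = Poly_Mapping.single (Poly_Mapping.single n 1) 1"

definition const :: "'k::comm_ring_1 \<Rightarrow> 'k dpoly" where
  "const c = Poly_Mapping.single 0 c"

(* Derivative of a monomial: x_n' = x_{n+1}, Leibniz rule.*)
definition dmono :: "(nat \<Rightarrow>\<^sub>0 nat) \<Rightarrow> 'k::comm_ring_1 dpoly" where
  "dmono m = (\<Sum>i\<in>Poly_Mapping.keys m. Poly_Mapping.single
      (m - Poly_Mapping.single i 1 + Poly_Mapping.single (Suc i) 1) (of_nat (Poly_Mapping.lookup m i)))"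

definition deriv :: "'k::comm_ring_1 dpoly \<Rightarrow> 'k dpoly" where
  "deriv p = (\<Sum>m\<in>Poly_Mapping.keys p. const (Poly_Mapping.lookup p m) * dmono m)"

definition kplus :: "'k::comm_ring_1 dpoly set" where
  "kplus = {p. Poly_Mapping.lookup p 0 = 0}"

definition diff_ideal :: "'k::comm_ring_1 dpoly set \<Rightarrow> bool" where
  "diff_ideal I \<longleftrightarrow> I \<subseteq> kplus \<and> 0 \<in> I
     \<and> (\<forall>a\<in>I. \<forall>b\<in>I. a + b \<in> I)
     \<and> (\<forall>c. \<forall>a\<in>I. const c * a \<in> I)
     \<and> (\<forall>r\<in>kplus. \<forall>a\<in>I. r * a \<in> I)
     \<and> (\<forall>a\<in>I. deriv a \<in> I)"

definition x2_ideal :: "'k::comm_ring_1 dpoly set" where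
  "x2_ideal = \<Inter>{I. diff_ideal I \<and> var 0 ^ 2 \<in> I}"

end

theory Submission
  imports Defs "HOL-Computational_Algebra.Polynomial" "HOL-Combinatorics.Permutations"
    "HOL-Library.Product_Lexorder"
begin

text \<open>
  If \<open>\<psi>\<close> and \<open>\<phi>\<close> are odd fields, then \<open>(\<psi>\<phi>)\<^sup>2 = 0\<close>, so \<open>x \<mapsto> \<psi>\<phi>\<close> kills \<open>[x\<^sup>2]\<close>.
  With \<open>\<psi> = \<Sum>\<xi>\<^sub>a U\<^sub>a(t)\<close>, \<open>\<phi> = \<Sum>\<eta>\<^sub>b V\<^sub>b(t)\<close> and odd constants \<open>\<xi>\<^sub>a, \<eta>\<^sub>b\<close> only the products
  \<open>\<xi>\<^sub>a\<eta>\<^sub>b\<close> occur; instead of constructing a Grassmann algebra they are replaced by commuting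
  variables \<open>e\<^sub>a\<^sub>b\<close>, followed by the linear functional that reads off the coefficient of the top
  form, i.e. sends the graph of a permutation to its sign.

  Modulo \<open>[x\<^sup>2]\<close> every differential polynomial is a combination of the monomials
  \<open>x\<^bsub>i(0)\<^esub> \<dots> x\<^bsub>i(n-1)\<^esub>\<close> with \<open>i(j+1) \<ge> i(j) + 2\<close>, and a nonzero combination \<open>p\<close> of these is detected
  by choosing \<open>U\<^sub>a = t\<^sup>a\<close>, \<open>V\<^sub>b = t\<^bsup>g(b)\<^esup>\<close> with \<open>g(a) = i(a) - a\<close> for the least spread monomial
  of \<open>p\<close> in some degree \<open>n\<close>.

  Given nonzero \<open>p\<close> and \<open>q\<close>, localize the functions detecting \<open>p\<close> near \<open>t = 1\<close> and those
  detecting \<open>q\<close> near \<open>t = 0\<close> (up to high order, by the Chinese remainder theorem). Then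
  \<open>p(1) q(0)\<close> is detected by the product of the two values, while \<open>p(1)\<close> is by Taylor's formula a
  combination of the values at 0 of the derivatives of \<open>p\<close>. Hence some \<open>p\<^bsup>(i)\<^esup> q\<close> is nonzero.
\<close>

subsection \<open>Evaluation of differential polynomials\<close>

abbreviation "lookup \<equiv> Poly_Mapping.lookup"
abbreviation "keys \<equiv> Poly_Mapping.keys"
abbreviation "single \<equiv> Poly_Mapping.single"

text \<open>One frame for \<open>deriv\<close>, \<open>eval\<close> and \<open>omega\<close>. The
  coefficient is an argument of \<open>s\<close> rather than a factor, so that it may be carried
  into another ring.\<close>

definition lin_ext :: "('m \<Rightarrow> 'a::zero \<Rightarrow> 'b::comm_monoid_add) \<Rightarrow> ('m \<Rightarrow>\<^sub>0 'a) \<Rightarrow> 'b" where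
  "lin_ext s p = (\<Sum>m\<in>keys p. s m (lookup p m))"

definition additive_family :: "('m \<Rightarrow> 'a::ab_group_add \<Rightarrow> 'b::ab_group_add) \<Rightarrow> bool" where
  "additive_family s \<longleftrightarrow> (\<forall>m a b. s m (a + b) = s m a + s m b)"

lemma additive_family_zero: "additive_family s \<Longrightarrow> s m 0 = 0"
  unfolding additive_family_def by (metis add_cancel_right_right add.right_neutral)

lemma lin_ext_superset:
  assumes "additive_family s" "finite S" "keys p \<subseteq> S"
  shows "lin_ext s p = (\<Sum>m\<in>S. s m (lookup p m))"
  unfolding lin_ext_def using assms
  by (intro sum.mono_neutral_left) (auto simp: in_keys_iff additive_family_zero)

lemma lin_ext_zero [simp]: "lin_ext s 0 = 0"
  by (simp add: lin_ext_def)

lemma lin_ext_add: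
  assumes "additive_family s"
  shows "lin_ext s (p + q) = lin_ext s p + lin_ext s q"
proof -
  let ?S = "keys p \<union> keys q"
  have "lin_ext s (p + q) = (\<Sum>m\<in>?S. s m (lookup (p + q) m))"
    by (rule lin_ext_superset) (use assms in \<open>auto simp: Poly_Mapping.keys_add\<close>)
  also have "\<dots> = (\<Sum>m\<in>?S. s m (lookup p m)) + (\<Sum>m\<in>?S. s m (lookup q m))"
    using assms by (simp add: lookup_add additive_family_def sum.distrib)
  also have "\<dots> = lin_ext s p + lin_ext s q"
    using assms by (simp add: lin_ext_superset[of s ?S])
  finally show ?thesis .
qed

lemma lin_ext_sum:
  assumes "additive_family s"
  shows "lin_ext s (sum p I) = (\<Sum>i\<in>I. lin_ext s (p i))"
  by (induction I rule: infinite_finite_induct) (auto simp: lin_ext_add assms)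

lemma lin_ext_single:
  assumes "additive_family s"
  shows "lin_ext s (single m c) = s m c"
  using assms by (subst lin_ext_superset[of s "{m}"]) (auto simp: additive_family_zero)

lemma poly_mapping_sum_single: "(\<Sum>m\<in>keys p. single m (lookup p m)) = p"
proof (rule poly_mapping_eqI)
  fix k
  have "lookup (\<Sum>m\<in>keys p. single m (lookup p m)) k = (\<Sum>m\<in>keys p. if m = k then lookup p m else 0)"
    by (simp add: lookup_sum lookup_single when_def)
  also have "\<dots> = lookup p k"
    by (simp add: in_keys_iff)
  finally show "lookup (\<Sum>m\<in>keys p. single m (lookup p m)) k = lookup p k" .
qed

lemma lin_ext_mult:
  fixes p q :: "('m::monoid_add) \<Rightarrow>\<^sub>0 ('a::ring)"
  assumes "additive_family s"
  shows "lin_ext s (p * q) = (\<Sum>m\<in>keys p. \<Sum>n\<in>keys q. s (m + n) (lookup p m * lookup q n))"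
proof -
  have "p * q = (\<Sum>m\<in>keys p. single m (lookup p m)) * (\<Sum>n\<in>keys q. single n (lookup q n))"
    by (simp only: poly_mapping_sum_single)
  also have "\<dots> = (\<Sum>m\<in>keys p. \<Sum>n\<in>keys q. single (m + n) (lookup p m * lookup q n))"
    by (simp add: sum_product mult_single)
  finally show ?thesis
    using assms by (simp add: lin_ext_sum lin_ext_single)
qed

definition mono_eval :: "('v \<Rightarrow> 'r::comm_monoid_mult) \<Rightarrow> ('v \<Rightarrow>\<^sub>0 nat) \<Rightarrow> 'r" where
  "mono_eval f m = (\<Prod>i\<in>keys m. f i ^ lookup m i)"

lemma mono_eval_superset:
  assumes "finite S" "keys m \<subseteq> S"
  shows "mono_eval f m = (\<Prod>i\<in>S. f i ^ lookup m i)"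
  unfolding mono_eval_def using assms
  by (intro prod.mono_neutral_left) (auto simp: in_keys_iff)

lemma mono_eval_add: "mono_eval f (m + n) = mono_eval f m * mono_eval f n"
proof -
  let ?S = "keys m \<union> keys n"
  have "mono_eval f (m + n) = (\<Prod>i\<in>?S. f i ^ lookup (m + n) i)"
    by (rule mono_eval_superset) (auto simp: Poly_Mapping.keys_add)
  also have "\<dots> = (\<Prod>i\<in>?S. f i ^ lookup m i) * (\<Prod>i\<in>?S. f i ^ lookup n i)"
    by (simp add: lookup_add power_add prod.distrib)
  finally show ?thesis
    by (simp add: mono_eval_superset[of ?S])
qed

lemma mono_eval_zero [simp]: "mono_eval f 0 = 1"
  by (simp add: mono_eval_def)

lemma mono_eval_single [simp]: "mono_eval f (single i 1) = f i"
  by (simp add: mono_eval_def)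

lemma mono_eval_sum: "mono_eval f (sum m I) = (\<Prod>i\<in>I. mono_eval f (m i))"
  by (induction I rule: infinite_finite_induct) (auto simp: mono_eval_add)

text \<open>Used with two targets: \<open>'k epoly poly\<close> for substituting functions of t, and
  \<open>'k epoly\<close> for substituting their values at a point.\<close>

locale scalar_hom =
  fixes \<kappa> :: "'k::comm_ring_1 \<Rightarrow> 'r::comm_ring_1"
  assumes hom_add: "\<kappa> (a + b) = \<kappa> a + \<kappa> b"
    and hom_mult: "\<kappa> (a * b) = \<kappa> a * \<kappa> b"
    and hom_one: "\<kappa> 1 = 1"
begin

definition eval :: "(nat \<Rightarrow> 'r) \<Rightarrow> 'k dpoly \<Rightarrow> 'r" where
  "eval f = lin_ext (\<lambda>m c. \<kappa> c * mono_eval f m)"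

lemma additive_family_eval: "additive_family (\<lambda>m c. \<kappa> c * mono_eval f m)"
  by (simp add: additive_family_def hom_add algebra_simps)

lemma eval_add: "eval f (p + q) = eval f p + eval f q"
  unfolding eval_def by (rule lin_ext_add[OF additive_family_eval])

lemma eval_zero [simp]: "eval f 0 = 0"
  unfolding eval_def by simp

lemma eval_sum: "eval f (sum p I) = (\<Sum>i\<in>I. eval f (p i))"
  unfolding eval_def by (rule lin_ext_sum[OF additive_family_eval])

lemma eval_single: "eval f (single m c) = \<kappa> c * mono_eval f m"
  unfolding eval_def by (rule lin_ext_single[OF additive_family_eval])

lemma eval_mult: "eval f (p * q) = eval f p * eval f q"
proof -
  have "eval f (p * q) = (\<Sum>m\<in>keys p. \<Sum>n\<in>keys q.
      \<kappa> (lookup p m * lookup q n) * mono_eval f (m + n))"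
    unfolding eval_def by (rule lin_ext_mult[OF additive_family_eval])
  also have "\<dots> = eval f p * eval f q"
    by (simp add: eval_def lin_ext_def sum_product hom_mult mono_eval_add mult_ac)
  finally show ?thesis .
qed

lemma eval_const: "eval f (const c) = \<kappa> c"
  by (simp add: const_def eval_single)

lemma eval_var: "eval f (var i) = f i"
  unfolding var_def eval_single mono_eval_single by (simp add: hom_one)

lemma eval_cong:
  assumes "\<And>m i. m \<in> keys p \<Longrightarrow> i \<in> keys m \<Longrightarrow> f i = g i"
  shows "eval f p = eval g p"
  unfolding eval_def lin_ext_def mono_eval_def
  by (intro sum.cong refl arg_cong2[of _ _ _ _ "(*)"] prod.cong) (auto simp: assms)

end

lemma single_sum: "single m (sum c I) = (\<Sum>i\<in>I. single m (c i))"
  by (induction I rule: infinite_finite_induct) (auto simp: single_add)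

section \<open>Substitutions that commute with the derivation\<close>

lemma deriv_eq_lin_ext: "deriv = lin_ext (\<lambda>m c. const c * dmono m)"
  by (simp add: fun_eq_iff deriv_def lin_ext_def)

lemma additive_family_deriv: "additive_family (\<lambda>m c. const c * (dmono m :: 'k::comm_ring_1 dpoly))"
  by (simp add: additive_family_def const_def single_add algebra_simps)

lemma deriv_sum: "deriv (sum p I) = (\<Sum>i\<in>I. deriv (p i))"
  unfolding deriv_eq_lin_ext by (rule lin_ext_sum[OF additive_family_deriv])

lemma deriv_single: "deriv (single m c) = const c * dmono m"
  unfolding deriv_eq_lin_ext by (rule lin_ext_single[OF additive_family_deriv])

text \<open>The product rule takes one factor \<open>f i\<close> out of the i-th power and puts in
  \<open>f (Suc i)\<close>, with the multiplicity as coefficient: term by term the image of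
  \<open>dmono m\<close>.\<close>

lemma pderiv_mono_eval:
  fixes f :: "nat \<Rightarrow> 'r::idom poly"
  assumes "\<And>i. pderiv (f i) = f (Suc i)"
  shows "pderiv (mono_eval f m) =
    (\<Sum>i\<in>keys m. of_nat (lookup m i) * mono_eval f (m - single i 1 + single (Suc i) 1))"
proof -
  have "prod (\<lambda>j. f j ^ lookup m j) (keys m - {i}) * pderiv (f i ^ lookup m i) =
      of_nat (lookup m i) * mono_eval f (m - single i 1 + single (Suc i) 1)"
    if i: "i \<in> keys m" for i
  proof -
    have "mono_eval f (m - single i 1) = (\<Prod>j\<in>keys m. f j ^ lookup (m - single i 1) j)"
      by (rule mono_eval_superset) (auto simp: in_keys_iff lookup_minus)
    also have "\<dots> = f i ^ (lookup m i - 1) * (\<Prod>j\<in>keys m - {i}. f j ^ lookup (m - single i 1) j)"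
      by (subst prod.remove[OF _ i]) (auto simp: lookup_minus)
    also have "(\<Prod>j\<in>keys m - {i}. f j ^ lookup (m - single i 1) j) =
        (\<Prod>j\<in>keys m - {i}. f j ^ lookup m j)"
      by (intro prod.cong) (auto simp: lookup_minus lookup_single when_def)
    finally show ?thesis
      by (simp only: mono_eval_add mono_eval_single)
        (simp add: pderiv_power assms of_nat_poly mult_ac)
  qed
  then show ?thesis
    by (simp add: mono_eval_def pderiv_prod cong: sum.cong)
qed

lemma eval_deriv:
  fixes \<kappa> :: "'k::comm_ring_1 \<Rightarrow> 'r::idom poly"
  assumes "scalar_hom \<kappa>" "\<And>i. pderiv (f i) = f (Suc i)" "\<And>c. pderiv (\<kappa> c) = 0"
  shows "scalar_hom.eval \<kappa> f (deriv p) = pderiv (scalar_hom.eval \<kappa> f p)"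
proof -
  interpret scalar_hom \<kappa> by fact
  have \<kappa>0: "\<kappa> 0 = 0" using hom_add[of 0 0] by (metis add.right_neutral add_cancel_right_right)
  have \<kappa>nat: "\<kappa> (of_nat n) = of_nat n" for n
    by (induction n) (auto simp: hom_add hom_one \<kappa>0)
  have mono: "eval f (dmono m) = pderiv (mono_eval f m)" for m
    unfolding dmono_def eval_sum eval_single pderiv_mono_eval[of f, OF assms(2)] \<kappa>nat ..
  have "eval f (deriv p) = (\<Sum>m\<in>keys p. \<kappa> (lookup p m) * pderiv (mono_eval f m))"
    by (simp add: deriv_def eval_sum eval_mult eval_const mono)
  also have "\<dots> = pderiv (eval f p)"
    by (simp add: eval_def lin_ext_def higher_pderiv_sum[of 1, simplified] pderiv_mult assms(3))
  finally show ?thesis .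
qed

subsection \<open>The sign functional\<close>

type_synonym 'k epoly = "((nat \<times> nat) \<Rightarrow>\<^sub>0 nat) \<Rightarrow>\<^sub>0 'k"

definition graph_mono :: "nat set \<Rightarrow> (nat \<Rightarrow> nat) \<Rightarrow> (nat \<times> nat) \<Rightarrow>\<^sub>0 nat" where
  "graph_mono X p = (\<Sum>i\<in>X. single (i, p i) 1)"

lemma lookup_graph_mono:
  assumes "finite X"
  shows "lookup (graph_mono X p) (i, j) = (if i \<in> X \<and> p i = j then 1 else 0)"
proof -
  have "lookup (graph_mono X p) (i, j) = (\<Sum>k\<in>X. if k = i then (if p i = j then 1 else 0) else 0)"
    unfolding graph_mono_def lookup_sum
    by (intro sum.cong) (auto simp: lookup_single when_def)
  then show ?thesis using assms by simp
qed

lemma graph_mono_inj: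
  assumes "finite X" "p permutes X" "q permutes X" "graph_mono X p = graph_mono X q"
  shows "p = q"
proof
  fix i
  show "p i = q i"
  proof (cases "i \<in> X")
    case True
    then have "lookup (graph_mono X q) (i, p i) = 1"
      using assms(1) by (simp flip: assms(4) add: lookup_graph_mono)
    then show ?thesis
      using assms(1) by (simp add: lookup_graph_mono split: if_splits)
  qed (use assms in \<open>simp add: permutes_not_in\<close>)
qed

text \<open>The coefficient of the top form in the product of the \<xi>_a \<eta>_b that the monomial
  stands for: reordering the \<eta>_b costs the sign of the permutation, and products of any other
  shape count as 0. For finite X the choice by \<open>THE\<close> is justified by
  \<open>graph_mono_inj\<close>.\<close>

definition graph_sign :: "nat set \<Rightarrow> ((nat \<times> nat) \<Rightarrow>\<^sub>0 nat) \<Rightarrow> 'k::comm_ring_1" where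
  "graph_sign X M = (if \<exists>p. p permutes X \<and> M = graph_mono X p
     then of_int (sign (THE p. p permutes X \<and> M = graph_mono X p)) else 0)"

lemma graph_sign_graph_mono:
  assumes "finite X" "p permutes X"
  shows "graph_sign X (graph_mono X p) = of_int (sign p)"
proof -
  have "(THE q. q permutes X \<and> graph_mono X p = graph_mono X q) = p"
    using assms graph_mono_inj by blast
  then show ?thesis using assms by (auto simp: graph_sign_def)
qed

lemma graph_sign_eq_0:
  assumes "\<And>p. p permutes X \<Longrightarrow> M \<noteq> graph_mono X p"
  shows "graph_sign X M = 0"
  using assms by (auto simp: graph_sign_def)

text \<open>A graph monomial has exactly one entry in each row, with multiplicity 1. So the two
  factors lie in different rows a and c, and exchanging their columns precomposes p with a
  transposition.\<close>

lemma graph_mono_transpose: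
  assumes "finite X" "p permutes X"
    and eq: "M + single (a, b) 1 + single (c, d) 1 = graph_mono X p"
  shows "a \<in> X" "c \<in> X" "a \<noteq> c"
    and "M + single (a, d) 1 + single (c, b) 1 = graph_mono X (p \<circ> transpose a c)"
proof -
  have L: "lookup M (i, j) + (if i = a \<and> j = b then 1 else 0) + (if i = c \<and> j = d then 1 else 0)
      = (if i \<in> X \<and> p i = j then 1 else 0)" for i j
    using arg_cong[OF eq, of "\<lambda>m. lookup m (i, j)"] assms(1)
    by (auto simp: lookup_graph_mono lookup_add lookup_single when_def split: if_splits)
  show aX: "a \<in> X" using L[of a b] by (auto split: if_splits)
  show cX: "c \<in> X" using L[of c d] by (auto split: if_splits)
  have pa: "p a = b" using L[of a b] by (auto split: if_splits)
  have pc: "p c = d" using L[of c d] by (auto split: if_splits)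
  show ac: "a \<noteq> c"
    using L[of a b] pa pc by (auto split: if_splits)
  show "M + single (a, d) 1 + single (c, b) 1 = graph_mono X (p \<circ> transpose a c)"
  proof (rule poly_mapping_eqI)
    fix ij :: "nat \<times> nat"
    obtain i j where ij: "ij = (i, j)" by fastforce
    have R: "lookup (M + single (a, d) 1 + single (c, b) 1) ij =
        lookup M (i, j) + (if i = a \<and> j = d then 1 else 0) + (if i = c \<and> j = b then 1 else 0)"
      by (simp add: ij lookup_add lookup_single when_def)
    consider "i = a" | "i = c" | "i \<noteq> a" "i \<noteq> c" by blast
    then show "lookup (M + single (a, d) 1 + single (c, b) 1) ij =
        lookup (graph_mono X (p \<circ> transpose a c)) ij"
      unfolding R
    proof cases
      case 1
      then show "lookup M (i, j) + (if i = a \<and> j = d then 1 else 0) + (if i = c \<and> j = b then 1 else 0)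
        = lookup (graph_mono X (p \<circ> transpose a c)) ij"
        using L[of a j] ac aX pa pc assms(1) by (simp add: ij lookup_graph_mono split: if_splits)
    next
      case 2
      then show "lookup M (i, j) + (if i = a \<and> j = d then 1 else 0) + (if i = c \<and> j = b then 1 else 0)
        = lookup (graph_mono X (p \<circ> transpose a c)) ij"
        using L[of c j] ac cX pa pc assms(1) by (simp add: ij lookup_graph_mono split: if_splits)
    next
      case 3
      then show "lookup M (i, j) + (if i = a \<and> j = d then 1 else 0) + (if i = c \<and> j = b then 1 else 0)
        = lookup (graph_mono X (p \<circ> transpose a c)) ij"
        using L[of i j] assms(1) by (simp add: ij lookup_graph_mono)
    qed
  qed
qed

text \<open>This plays the role of the anticommutation of \<eta>_b and \<eta>_d.\<close>

lemma graph_sign_swap: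
  assumes "finite X"
  shows "(graph_sign X (M + single (a, b) 1 + single (c, d) 1) :: 'k::comm_ring_1) =
    - graph_sign X (M + single (a, d) 1 + single (c, b) 1)"
proof -
  have *: "(graph_sign X (M + single (a, b) 1 + single (c, d) 1) :: 'k) =
    - graph_sign X (M + single (a, d) 1 + single (c, b) 1)"
    if p: "p permutes X" "M + single (a, b) 1 + single (c, d) 1 = graph_mono X p" for p a b c d
  proof -
    note T = graph_mono_transpose[OF assms p]
    have "p \<circ> transpose a c permutes X"
      using T p by (intro permutes_compose permutes_swap_id)
    moreover have "sign (p \<circ> transpose a c) = - sign p"
    proof (subst sign_compose)
      show "permutation p" using p(1) assms by (rule permutes_imp_permutation[rotated])
    qed (use T(3) in \<open>simp_all add: permutation_swap_id sign_swap_id\<close>)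
    ultimately show ?thesis
      unfolding T(4) p(2) using p assms by (simp add: graph_sign_graph_mono)
  qed
  \<comment> \<open>Exchanging the columns twice restores the monomial, so \<open>*\<close> also
    covers the case where only the exchanged monomial is a graph. If neither is one, both sides are
    0.\<close>
  show ?thesis
  proof (cases "\<exists>p. p permutes X \<and> M + single (a, b) 1 + single (c, d) 1 = graph_mono X p")
    case True
    then show ?thesis using * by blast
  next
    case 1: False
    show ?thesis
    proof (cases "\<exists>p. p permutes X \<and> M + single (a, d) 1 + single (c, b) 1 = graph_mono X p")
      case True
      then have "(graph_sign X (M + single (a, d) 1 + single (c, b) 1) :: 'k) =
          - graph_sign X (M + single (a, b) 1 + single (c, d) 1)"
        using * by blast
      then show ?thesis by (metis minus_minus)
    next
      case False
      then have "graph_sign X (M + single (a, d) 1 + single (c, b) 1) = (0::'k)"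
        by (intro graph_sign_eq_0) blast
      moreover have "graph_sign X (M + single (a, b) 1 + single (c, d) 1) = (0::'k)"
        using 1 by (intro graph_sign_eq_0) blast
      ultimately show ?thesis by (simp only: minus_zero)
    qed
  qed
qed

section \<open>Block-diagonal permutations\<close>

lemma graph_mono_Un:
  assumes "finite X" "finite Y" "X \<inter> Y = {}" "p permutes X" "q permutes Y"
  shows "graph_mono X p + graph_mono Y q = graph_mono (X \<union> Y) (p \<circ> q)"
proof -
  have "graph_mono X (p \<circ> q) = graph_mono X p"
    unfolding graph_mono_def
  proof (intro sum.cong refl)
    fix i assume "i \<in> X"
    then have "q i = i" using assms by (intro permutes_not_in[of q Y]) auto
    then show "single (i, (p \<circ> q) i) 1 = single (i, p i) (1::nat)" by simp
  qed
  moreover have "graph_mono Y (p \<circ> q) = graph_mono Y q"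
    unfolding graph_mono_def
  proof (intro sum.cong refl)
    fix i assume "i \<in> Y"
    then have "q i \<notin> X" using assms permutes_in_image[of q Y i] by auto
    then show "single (i, (p \<circ> q) i) 1 = single (i, q i) (1::nat)"
      using assms by (simp add: permutes_not_in)
  qed
  ultimately show ?thesis
    using assms by (simp add: graph_mono_def sum.union_disjoint)
qed

text \<open>For i in X the factor \<open>N\<close> has no entry in row i, so the entry of the graph
  at (i, r i) comes from \<open>M\<close>, whose entries lie in X x X. Thus r maps X into itself,
  and bijectively because X is finite.\<close>

lemma graph_mono_split:
  assumes "finite X" "finite Y" "X \<inter> Y = {}" "keys M \<subseteq> X \<times> X" "keys N \<subseteq> Y \<times> Y"
    and r: "r permutes X \<union> Y" "M + N = graph_mono (X \<union> Y) r"
  shows "restrict_id r X permutes X" "M = graph_mono X (restrict_id r X)"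
proof -
  have L: "lookup M (i, j) + lookup N (i, j) = (if i \<in> X \<union> Y \<and> r i = j then 1 else 0)" for i j
    using arg_cong[OF r(2), of "\<lambda>m. lookup m (i, j)"] assms(1,2)
    by (simp add: lookup_graph_mono lookup_add)
  have M0: "lookup M (i, j) = 0" if "i \<notin> X \<or> j \<notin> X" for i j
    using that assms(4) by (auto simp: subset_iff in_keys_iff)
  have N0: "lookup N (i, j) = 0" if "i \<notin> Y \<or> j \<notin> Y" for i j
    using that assms(5) by (auto simp: subset_iff in_keys_iff)
  have rX: "r i \<in> X" if "i \<in> X" for i
  proof (rule ccontr)
    assume "r i \<notin> X"
    moreover have "i \<notin> Y" using that assms(3) by auto
    ultimately show False using L[of i "r i"] M0[of i "r i"] N0[of i "r i"] that by simp
  qed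
  have inj: "inj_on r X" using permutes_inj[OF r(1)] by (auto intro: inj_on_subset)
  have "bij_betw r X X"
    using endo_inj_surj[OF assms(1) _ inj] rX inj by (auto simp: bij_betw_def)
  then show "restrict_id r X permutes X"
    by (rule permutes_restrict_id)
  show "M = graph_mono X (restrict_id r X)"
  proof (rule poly_mapping_eqI)
    fix ij :: "nat \<times> nat"
    obtain i j where ij: "ij = (i, j)" by fastforce
    show "lookup M ij = lookup (graph_mono X (restrict_id r X)) ij"
    proof (cases "i \<in> X")
      case True
      then have "i \<notin> Y" using assms(3) by auto
      then show ?thesis using True L[of i j] N0[of i j] assms(1)
        by (simp add: ij lookup_graph_mono)
    qed (simp add: ij M0 lookup_graph_mono assms(1))
  qed
qed

lemma graph_sign_add:
  assumes "finite X" "finite Y" "X \<inter> Y = {}" "keys M \<subseteq> X \<times> X" "keys N \<subseteq> Y \<times> Y"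
  shows "(graph_sign (X \<union> Y) (M + N) :: 'k::comm_ring_1) = graph_sign X M * graph_sign Y N"
proof (cases "\<exists>p q. p permutes X \<and> q permutes Y \<and> M = graph_mono X p \<and> N = graph_mono Y q")
  case True
  then obtain p q where pq: "p permutes X" "q permutes Y" "M = graph_mono X p" "N = graph_mono Y q"
    by blast
  have "p \<circ> q permutes X \<union> Y"
    using pq by (intro permutes_compose) (auto intro: permutes_subset)
  moreover have "sign (p \<circ> q) = sign p * sign q"
    using pq assms by (intro sign_compose) (auto simp: permutation_permutes)
  ultimately show ?thesis
    using assms pq by (simp add: graph_mono_Un graph_sign_graph_mono)
next
  case False
  have "graph_sign (X \<union> Y) (M + N) = (0::'k)"
  proof (rule graph_sign_eq_0, rule notI)
    fix r assume r: "r permutes X \<union> Y" "M + N = graph_mono (X \<union> Y) r"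
    then have r': "r permutes Y \<union> X" "N + M = graph_mono (Y \<union> X) r"
      by (simp_all add: Un_commute add.commute)
    \<comment> \<open>Splitting once more with X and Y exchanged yields the second block as a
      permutation graph.\<close>
    have "Y \<inter> X = {}" using assms by auto
    from graph_mono_split[OF assms r] graph_mono_split[OF assms(2,1) this assms(5,4) r']
    show False using False by blast
  qed
  moreover have "graph_sign X M = (0::'k) \<or> graph_sign Y N = (0::'k)"
    using False by (auto simp: graph_sign_def)
  ultimately show ?thesis by auto
qed

definition omega :: "nat set \<Rightarrow> 'k::comm_ring_1 epoly \<Rightarrow> 'k" where
  "omega X = lin_ext (\<lambda>M c. c * graph_sign X M)"

lemma additive_family_omega: "additive_family (\<lambda>M c. c * (graph_sign X M :: 'k::comm_ring_1))"
  by (simp add: additive_family_def algebra_simps)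

lemma omega_add: "omega X (p + q) = omega X p + omega X q"
  unfolding omega_def by (rule lin_ext_add[OF additive_family_omega])

lemma omega_zero [simp]: "omega X 0 = 0"
  by (simp add: omega_def)

lemma omega_sum: "omega X (sum p I) = (\<Sum>i\<in>I. omega X (p i))"
  unfolding omega_def by (rule lin_ext_sum[OF additive_family_omega])

lemma omega_mult: "omega X (p * q) =
    (\<Sum>m\<in>keys p. \<Sum>n\<in>keys q. lookup p m * lookup q n * graph_sign X (m + n))"
  unfolding omega_def by (rule lin_ext_mult[OF additive_family_omega])

lemma omega_scale: "omega X (single 0 c * p) = c * omega X p"
  by (cases "c = 0") (simp_all add: omega_mult, simp add: omega_def lin_ext_def sum_distrib_left mult_ac)

lemma omega_of_nat: "omega X (of_nat n * p) = of_nat n * omega X p"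
  by (induction n) (auto simp: algebra_simps omega_add)

lemma omega_minus: "omega X (p - q) = omega X p - omega X q"
  using omega_add[of X "p - q" q] by simp

definition evar :: "nat \<Rightarrow> nat \<Rightarrow> 'k::comm_ring_1 epoly" where
  "evar a b = single (single (a, b) 1) 1"

lemma omega_swap:
  assumes "finite X"
  shows "omega X (evar a b * evar c d * h) = - omega X (evar a d * evar c b * h)"
proof -
  have "omega X (evar a b * evar c d * h) =
      (\<Sum>m\<in>keys h. lookup h m * graph_sign X (m + single (a, b) 1 + single (c, d) 1))" for a b c d
    by (simp add: evar_def mult_single omega_mult add_ac)
  note * = this
  show ?thesis
    unfolding * sum_negf[symmetric]
    by (intro sum.cong refl, subst graph_sign_swap[OF assms]) (rule mult_minus_right)
qed

lemma omega_mult_disjoint: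
  assumes "finite X" "finite Y" "X \<inter> Y = {}"
    and "\<And>M. M \<in> keys p \<Longrightarrow> keys M \<subseteq> X \<times> X" "\<And>N. N \<in> keys q \<Longrightarrow> keys N \<subseteq> Y \<times> Y"
  shows "omega (X \<union> Y) (p * q) = omega X p * omega Y q"
proof -
  have "omega (X \<union> Y) (p * q) =
      (\<Sum>m\<in>keys p. \<Sum>n\<in>keys q. (lookup p m * graph_sign X m) * (lookup q n * graph_sign Y n))"
    unfolding omega_mult using assms
    by (intro sum.cong refl) (simp add: graph_sign_add mult_ac)
  also have "\<dots> = omega X p * omega Y q"
    by (simp add: omega_def lin_ext_def sum_product)
  finally show ?thesis .
qed

subsection \<open>Differential substitutions annihilating the ideal\<close>

lemma add_eq_0_poly_mapping_nat:
  fixes m n :: "'v \<Rightarrow>\<^sub>0 nat"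
  assumes "m + n = 0" shows "n = 0"
proof (rule poly_mapping_eqI)
  fix i
  show "lookup n i = lookup 0 i"
    using arg_cong[OF assms, of "\<lambda>m. lookup m i"] by (simp add: lookup_add)
qed

lemma kplus_mult: "q \<in> kplus \<Longrightarrow> p * q \<in> kplus"
  unfolding kplus_def mem_Collect_eq
proof (rule ccontr)
  assume q: "lookup q 0 = 0" and "lookup (p * q) 0 \<noteq> 0"
  then have "0 \<in> keys (p * q)" by (simp add: in_keys_iff)
  then obtain m n where "m \<in> keys p" "n \<in> keys q" "0 = m + n"
    using keys_mult[of p q] by blast
  then have "0 \<in> keys q" using add_eq_0_poly_mapping_nat[of m n] by simp
  with q show False by (simp add: in_keys_iff)
qed

lemma kplus_sum: "(\<And>i. i \<in> I \<Longrightarrow> p i \<in> kplus) \<Longrightarrow> sum p I \<in> kplus"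
  by (simp add: kplus_def lookup_sum)

lemma deriv_in_kplus: "deriv p \<in> kplus"
proof -
  have "m - single i 1 + single (Suc i) 1 \<noteq> (0 :: nat \<Rightarrow>\<^sub>0 nat)" for m i
    by (metis add_eq_0_poly_mapping_nat single_one single_zero inj_single lookup_single_eq lookup_zero zero_neq_one)
  then have "dmono m \<in> kplus" for m
    unfolding dmono_def by (intro kplus_sum) (simp add: kplus_def lookup_single when_def)
  then show ?thesis
    unfolding deriv_def by (intro kplus_sum kplus_mult)
qed

lemma x2_ideal_var: "var 0 ^ 2 \<in> x2_ideal"
  by (auto simp: x2_ideal_def)

lemma x2_ideal_diff_ideal: "diff_ideal (x2_ideal :: 'k::comm_ring_1 dpoly set)"
proof -
  \<comment> \<open>\<open>kplus\<close> itself belongs to the intersected family, which puts the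
    intersection inside \<open>kplus\<close>.\<close>
  have "diff_ideal (kplus :: 'k dpoly set)"
    unfolding diff_ideal_def by (auto simp: kplus_mult deriv_in_kplus) (auto simp: kplus_def lookup_add)
  moreover have "single 0 1 \<noteq> (0 :: nat \<Rightarrow>\<^sub>0 nat)"
    by (metis lookup_single_eq lookup_zero zero_neq_one)
  then have "var 0 \<in> (kplus :: 'k dpoly set)"
    by (simp add: kplus_def var_def lookup_single when_def)
  then have "var 0 ^ 2 \<in> (kplus :: 'k dpoly set)"
    by (simp add: power2_eq_square kplus_mult)
  ultimately have "x2_ideal \<subseteq> (kplus :: 'k dpoly set)"
    by (auto simp: x2_ideal_def)
  then show ?thesis
    unfolding diff_ideal_def[of x2_ideal] by (auto simp: x2_ideal_def diff_ideal_def)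
qed

text \<open>The kernel of a linear functional need not be an ideal. Testing all multiples
  \<open>G * F\<close> makes this set an ideal, and testing every power of t makes it closed under
  \<open>pderiv\<close>.\<close>

definition annih :: "nat set \<Rightarrow> 'k::comm_ring_1 epoly poly set" where
  "annih X = {F. \<forall>G i. omega X (coeff (G * F) i) = 0}"

lemma annih_add: "F \<in> annih X \<Longrightarrow> G \<in> annih X \<Longrightarrow> F + G \<in> annih X"
  by (simp add: annih_def algebra_simps omega_add)

lemma annih_mult: "F \<in> annih X \<Longrightarrow> G * F \<in> annih X"
  by (simp add: annih_def flip: mult.assoc)

lemma annih_pderiv:
  fixes F :: "'k::idom epoly poly"
  assumes "F \<in> annih X" shows "pderiv F \<in> annih X"
  unfolding annih_def mem_Collect_eq
proof (intro allI)
  fix G i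
  have "G * pderiv F = pderiv (G * F) - pderiv G * F"
    by (simp add: pderiv_mult algebra_simps)
  then have "omega X (coeff (G * pderiv F) i) =
      of_nat (Suc i) * omega X (coeff (G * F) (Suc i)) - omega X (coeff (pderiv G * F) i)"
    by (simp only: coeff_diff omega_minus coeff_pderiv omega_of_nat)
  then show "omega X (coeff (G * pderiv F) i) = 0"
    using assms by (simp add: annih_def)
qed

text \<open>The product \<psi>\<phi> of the two odd fields, with e_ab in place of \<xi>_a
  \<eta>_b.\<close>

definition theta_base :: "nat set \<Rightarrow> (nat \<Rightarrow> 'k epoly poly) \<Rightarrow> (nat \<Rightarrow> 'k epoly poly) \<Rightarrow>
    'k::comm_ring_1 epoly poly" where
  "theta_base X U V = (\<Sum>a\<in>X. \<Sum>b\<in>X. smult (evar a b) (U a * V b))"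

text \<open>In the expanded square, exchanging b and d fixes the product of the four functions but
  flips the sign of \<open>omega\<close>. The sum over b and d therefore equals its own
  negative.\<close>

lemma theta_base_square:
  fixes U V :: "nat \<Rightarrow> 'k::field_char_0 epoly poly"
  assumes "finite X"
  shows "theta_base X U V ^ 2 \<in> annih X"
  unfolding annih_def mem_Collect_eq
proof (intro allI)
  fix G :: "'k epoly poly" and i
  define w where "w = (\<lambda>a b c d. omega X (evar a b * evar c d * coeff (G * (U a * V b * (U c * V d))) i))"
  have "theta_base X U V ^ 2 = (\<Sum>a\<in>X. \<Sum>c\<in>X. \<Sum>b\<in>X. \<Sum>d\<in>X.
      smult (evar a b * evar c d) (U a * V b * (U c * V d)))"
    by (simp add: theta_base_def power2_eq_square sum_product mult_ac)
  then have "omega X (coeff (G * theta_base X U V ^ 2) i) = (\<Sum>a\<in>X. \<Sum>c\<in>X. \<Sum>b\<in>X. \<Sum>d\<in>X. w a b c d)"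
    by (simp add: sum_distrib_left coeff_sum omega_sum w_def)
  moreover have "(\<Sum>b\<in>X. \<Sum>d\<in>X. w a b c d) = 0" for a c
  proof -
    have w: "w a b c d = - w a d c b" for b d
      unfolding w_def by (subst omega_swap[OF assms]) (simp add: mult_ac)
    have "(\<Sum>b\<in>X. \<Sum>d\<in>X. w a b c d) = (\<Sum>d\<in>X. \<Sum>b\<in>X. w a b c d)"
      by (rule sum.swap)
    also have "\<dots> = - (\<Sum>d\<in>X. \<Sum>b\<in>X. w a d c b)"
      by (subst w) (simp add: sum_negf)
    finally show ?thesis by simp
  qed
  ultimately show "omega X (coeff (G * theta_base X U V ^ 2) i) = 0" by simp
qed

definition poly_scalar :: "'k::comm_ring_1 \<Rightarrow> 'k epoly poly" where
  "poly_scalar c = [:single 0 c:]"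

interpretation poly_scalar: scalar_hom poly_scalar
  by unfold_locales (simp_all add: poly_scalar_def single_add mult_single one_pCons mult.commute)

interpretation escalar: scalar_hom "single 0 :: 'k::comm_ring_1 \<Rightarrow> 'k epoly"
  by unfold_locales (simp_all add: single_add mult_single)

definition theta :: "nat set \<Rightarrow> (nat \<Rightarrow> 'k epoly poly) \<Rightarrow> (nat \<Rightarrow> 'k epoly poly) \<Rightarrow>
    'k::idom dpoly \<Rightarrow> 'k epoly poly" where
  "theta X U V = poly_scalar.eval (\<lambda>i. (pderiv ^^ i) (theta_base X U V))"

lemma theta_deriv: "theta X U V (deriv p) = pderiv (theta X U V p)"
  unfolding theta_def
  by (intro eval_deriv) (auto simp: poly_scalar.scalar_hom_axioms poly_scalar_def pderiv_pCons)

lemma theta_funpow_deriv: "theta X U V ((deriv ^^ i) p) = (pderiv ^^ i) (theta X U V p)"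
  by (induction i) (auto simp: theta_deriv)

text \<open>Since \<open>theta\<close> commutes with the derivations, the preimage of
  \<open>annih X\<close> in \<open>kplus\<close> is a differential ideal. It contains x^2, hence
  also the smallest such ideal.\<close>

lemma theta_x2_ideal:
  fixes U V :: "nat \<Rightarrow> 'k::field_char_0 epoly poly"
  assumes "finite X" "p \<in> x2_ideal"
  shows "theta X U V p \<in> annih X"
proof -
  let ?I = "{p \<in> kplus. theta X U V p \<in> annih X}"
  have "diff_ideal ?I"
    unfolding diff_ideal_def
    by (auto simp: theta_deriv annih_pderiv deriv_in_kplus kplus_mult)
      (auto simp: theta_def kplus_def poly_scalar.eval_add poly_scalar.eval_mult lookup_add annih_add annih_mult,
       auto simp: annih_def)
  moreover have "theta X U V (var 0 ^ 2) = theta_base X U V ^ 2"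
    by (simp add: theta_def power2_eq_square poly_scalar.eval_mult poly_scalar.eval_var)
  then have "var 0 ^ 2 \<in> ?I"
    using x2_ideal_var x2_ideal_diff_ideal theta_base_square[OF assms(1)]
    by (auto simp: diff_ideal_def)
  ultimately have "x2_ideal \<subseteq> ?I" unfolding x2_ideal_def by blast
  with assms(2) show ?thesis by blast
qed

text \<open>F(1) is the sum of the coefficients of F, and the i-th coefficient is the i-th
  derivative at 0 divided by i!. Each of these derivatives times G(0) is killed by
  \<open>omega X\<close>.\<close>

lemma omega_taylor:
  fixes F G :: "'k::field_char_0 epoly poly"
  assumes "\<And>i. (pderiv ^^ i) F * G \<in> annih X"
  shows "omega X (poly F 1 * coeff G 0) = 0"
proof -
  have "omega X (coeff F i * coeff G 0) = 0" for i
  proof -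
    have "omega X (coeff (1 * ((pderiv ^^ i) F * G)) 0) = 0"
      using assms[of i] unfolding annih_def by blast
    moreover have "coeff ((pderiv ^^ i) F) 0 = of_nat (fact i) * coeff F i"
      by (simp add: coeff_higher_pderiv flip: pochhammer_fact)
    ultimately have "omega X (of_nat (fact i) * (coeff F i * coeff G 0)) = 0"
      by (simp add: coeff_mult mult.assoc)
    then show ?thesis by (simp add: omega_of_nat del: of_nat_fact)
  qed
  then show ?thesis
    by (simp add: poly_altdef sum_distrib_right omega_sum)
qed

lemma poly_theta:
  "poly (theta X U V p) c =
    escalar.eval (\<lambda>i. \<Sum>a\<in>X. \<Sum>b\<in>X. evar a b * poly ((pderiv ^^ i) (U a * V b)) c) p"
  by (simp add: theta_def poly_scalar.eval_def escalar.eval_def lin_ext_def mono_eval_def poly_sum poly_prod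
      theta_base_def higher_pderiv_sum higher_pderiv_smult poly_scalar_def)

subsection \<open>Reduction to normal monomials\<close>

lemma x2_ideal_add: "p \<in> x2_ideal \<Longrightarrow> q \<in> x2_ideal \<Longrightarrow> p + q \<in> x2_ideal"
  and x2_ideal_const: "p \<in> x2_ideal \<Longrightarrow> const c * p \<in> x2_ideal"
  and x2_ideal_deriv: "p \<in> x2_ideal \<Longrightarrow> deriv p \<in> x2_ideal"
  and x2_ideal_0: "0 \<in> x2_ideal"
  using x2_ideal_diff_ideal unfolding diff_ideal_def by blast+

lemma const_mult_single: "const c * single m d = single m (c * d)"
  by (simp add: const_def mult_single)

lemma keys_uminus: "keys (- p) = keys (p :: 'v \<Rightarrow>\<^sub>0 'k::ab_group_add)"
  by (auto simp: in_keys_iff)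

lemma keys_lincomb:
  assumes "n \<in> keys (\<Sum>i\<in>I. const (c i) * q i)"
  obtains i where "i \<in> I" "n \<in> keys (q i)"
proof -
  have "(\<Sum>i\<in>I. lookup (const (c i) * q i) n) \<noteq> 0"
    using assms by (simp add: in_keys_iff lookup_sum)
  then obtain i where i: "i \<in> I" "n \<in> keys (const (c i) * q i)"
    unfolding in_keys_iff by (meson sum.neutral)
  with keys_mult[of "const (c i)" "q i"] have "n \<in> keys (q i)"
    by (auto simp: const_def split: if_splits)
  with i show thesis by (intro that)
qed

lemma const_minus_one: "const (- 1) * p = - p"
  by (simp add: const_def single_uminus)

lemma x2_ideal_uminus: "p \<in> x2_ideal \<Longrightarrow> - p \<in> x2_ideal"
  using x2_ideal_const[of p "-1"] by (simp add: const_minus_one)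

lemma x2_ideal_sum: "(\<And>i. i \<in> I \<Longrightarrow> p i \<in> x2_ideal) \<Longrightarrow> sum p I \<in> x2_ideal"
  by (induction I rule: infinite_finite_induct) (auto intro: x2_ideal_add x2_ideal_0)

lemma x2_ideal_mono:
  assumes "p \<in> x2_ideal" shows "single m 1 * p \<in> x2_ideal"
\<comment> \<open>The monomial 1 is not in \<open>kplus\<close>, so closure under multiplication by
  \<open>kplus\<close> covers only m \<noteq> 0.\<close>
proof (cases "m = 0")
  case False
  then have "single m 1 \<in> kplus" by (simp add: kplus_def lookup_single when_def)
  with assms x2_ideal_diff_ideal show ?thesis unfolding diff_ideal_def by blast
qed (simp add: assms)

section \<open>Relations given by the derivatives of x^2\<close>

definition pair_mono :: "nat \<Rightarrow> nat \<Rightarrow> nat \<Rightarrow>\<^sub>0 nat" where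
  "pair_mono i j = single i 1 + single j 1"

lemma dmono_pair_mono:
  "dmono (pair_mono i j) = (single (pair_mono (Suc i) j) 1 + single (pair_mono i (Suc j)) 1 :: 'k::comm_ring_1 dpoly)"
proof (cases "i = j")
  case True
  have "keys (pair_mono j j) = {j}" "lookup (pair_mono j j) j = 2"
    by (auto simp: pair_mono_def in_keys_iff lookup_add lookup_single when_def split: if_splits)
  moreover have "pair_mono j j - single j 1 + single (Suc j) 1 = pair_mono (Suc j) j"
    by (simp add: pair_mono_def add_ac)
  ultimately have "dmono (pair_mono j j) = (single (pair_mono (Suc j) j) 2 :: 'k dpoly)"
    by (simp add: dmono_def)
  also have "\<dots> = single (pair_mono (Suc j) j) 1 + single (pair_mono (Suc j) j) 1"
    by (simp flip: single_add)
  finally show ?thesis unfolding True by (simp add: pair_mono_def add_ac)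
next
  case False
  have "keys (pair_mono i j) = {i, j}" "lookup (pair_mono i j) i = 1" "lookup (pair_mono i j) j = 1"
    using False by (auto simp: pair_mono_def in_keys_iff lookup_add lookup_single when_def split: if_splits)
  moreover have "pair_mono i j - single i 1 + single (Suc i) 1 = pair_mono (Suc i) j"
    "pair_mono i j - single j 1 + single (Suc j) 1 = pair_mono i (Suc j)"
    by (simp_all add: pair_mono_def add_ac)
  ultimately show ?thesis
    using False by (simp add: dmono_def)
qed

text \<open>The r-th derivative of x_0^2, expanded by the Leibniz rule.\<close>

definition x2_deriv :: "nat \<Rightarrow> 'k::comm_ring_1 dpoly" where
  "x2_deriv r = (\<Sum>i\<le>r. single (pair_mono i (r - i)) (of_nat (r choose i)))"

lemma deriv_x2_deriv: "deriv (x2_deriv r) = x2_deriv (Suc r)"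
proof -
  let ?s = "\<lambda>i c. single (pair_mono i (Suc r - i)) (of_nat c :: 'a)"
  have "deriv (x2_deriv r) = (\<Sum>i\<le>r. const (of_nat (r choose i)) *
      (single (pair_mono (Suc i) (r - i)) 1 + single (pair_mono i (Suc (r - i))) 1 :: 'a dpoly))"
    by (simp add: x2_deriv_def deriv_sum deriv_single dmono_pair_mono)
  also have "\<dots> = (\<Sum>i\<le>r. ?s (Suc i) (r choose i)) + (\<Sum>i\<le>r. ?s i (r choose i))"
    by (simp add: distrib_left const_mult_single sum.distrib Suc_diff_le add.commute)
  \<comment> \<open>The added top term has binomial coefficient 0; after an index shift Pascal's
    rule applies.\<close>
  also have "(\<Sum>i\<le>r. ?s i (r choose i)) = (\<Sum>i\<le>Suc r. ?s i (r choose i))"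
    by (simp add: binomial_eq_0)
  also have "\<dots> = ?s 0 1 + (\<Sum>i\<le>r. ?s (Suc i) (r choose Suc i))"
    by (subst sum.atMost_Suc_shift) simp
  also have "(\<Sum>i\<le>r. ?s (Suc i) (r choose i)) + (?s 0 1 + (\<Sum>i\<le>r. ?s (Suc i) (r choose Suc i)))
      = ?s 0 1 + (\<Sum>i\<le>r. ?s (Suc i) (Suc r choose Suc i))"
    by (simp add: single_add sum.distrib algebra_simps)
  also have "\<dots> = (\<Sum>i\<le>Suc r. ?s i (Suc r choose i))"
    by (subst sum.atMost_Suc_shift) simp
  finally show ?thesis by (simp add: x2_deriv_def)
qed

lemma x2_deriv_in: "x2_deriv r \<in> x2_ideal"
proof (induction r)
  case 0
  have "x2_deriv 0 = var 0 ^ 2"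
    by (simp add: x2_deriv_def var_def power2_eq_square mult_single pair_mono_def)
  then show ?case using x2_ideal_var by metis
next
  case (Suc r)
  then show ?case using x2_ideal_deriv deriv_x2_deriv by metis
qed

text \<open>Constant 1 gives the degree and \<open>id\<close> the weight; powers of a base measure
  how spread out the indices are, and indicator functions recover the exponents.\<close>

definition wsum :: "('v \<Rightarrow> nat) \<Rightarrow> ('v \<Rightarrow>\<^sub>0 nat) \<Rightarrow> nat" where
  "wsum f m = (\<Sum>i\<in>keys m. lookup m i * f i)"

lemma wsum_add: "wsum f (m + n) = wsum f m + wsum f n"
proof -
  let ?S = "keys m \<union> keys n"
  have *: "wsum f x = (\<Sum>i\<in>?S. lookup x i * f i)" if "keys x \<subseteq> ?S" for x
    unfolding wsum_def using that by (intro sum.mono_neutral_left) (auto simp: in_keys_iff)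
  show ?thesis
    using Poly_Mapping.keys_add[of m n] by (simp add: * lookup_add algebra_simps sum.distrib)
qed

lemma wsum_zero [simp]: "wsum f 0 = 0"
  by (simp add: wsum_def)

lemma wsum_single [simp]: "wsum f (single i 1) = f i"
  by (simp add: wsum_def)

lemma wsum_sum: "wsum f (sum m I) = (\<Sum>i\<in>I. wsum f (m i))"
  by (induction I rule: infinite_finite_induct) (auto simp: wsum_add)

text \<open>Each occurring index is at most the total weight. This is the ceiling that makes the
  reduction terminate.\<close>

lemma wsum_exp_bound: "wsum (\<lambda>i. 2 ^ i) m \<le> wsum (\<lambda>_. 1) m * 2 ^ wsum id m"
proof -
  have "i \<le> wsum id m" if "i \<in> keys m" for i
  proof -
    have "i \<le> lookup m i * id i" using that by (auto simp: in_keys_iff)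
    also have "\<dots> \<le> wsum id m" unfolding wsum_def using that by (intro member_le_sum) auto
    finally show ?thesis .
  qed
  then show ?thesis
    unfolding wsum_def[of "\<lambda>i. 2 ^ i"] wsum_def[of "\<lambda>_. 1"] sum_distrib_right
    by (intro sum_mono) auto
qed

definition normal_mono :: "(nat \<Rightarrow>\<^sub>0 nat) \<Rightarrow> bool" where
  "normal_mono m \<longleftrightarrow> (\<forall>i. lookup m i + lookup m (Suc i) \<le> 1)"

lemma not_normal_mono:
  assumes "\<not> normal_mono m"
  obtains j l n where "l = j \<or> l = Suc j" "m = n + pair_mono j l"
proof -
  obtain i where "\<not> lookup m i + lookup m (Suc i) \<le> 1"
    using assms unfolding normal_mono_def by blast
  then have i: "2 \<le> lookup m i + lookup m (Suc i)" by linarith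
  note split = that
  have *: thesis if "l = j \<or> l = Suc j" "\<And>k. lookup (pair_mono j l) k \<le> lookup m k" for j l
  proof (rule split)
    show "m = (m - pair_mono j l) + pair_mono j l"
      by (rule poly_mapping_eqI) (use that in \<open>simp add: lookup_add lookup_minus\<close>)
  qed (use that in simp)
  consider "2 \<le> lookup m i" | "2 \<le> lookup m (Suc i)" | "1 \<le> lookup m i" "1 \<le> lookup m (Suc i)"
    using i by linarith
  then show thesis
  proof cases
    case 1
    then show thesis by (intro *[of i i]) (auto simp: pair_mono_def lookup_add lookup_single when_def)
  next
    case 2
    then show thesis by (intro *[of "Suc i" "Suc i"]) (auto simp: pair_mono_def lookup_add lookup_single when_def)
  next
    case 3
    then show thesis by (intro *[of "Suc i" i]) (auto simp: pair_mono_def lookup_add lookup_single when_def)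
  qed
qed

text \<open>Every other splitting of j + l has a part of size at least l + 1, and its power of 2
  alone reaches 2^j + 2^l.\<close>

lemma two_powers_less:
  fixes i j l :: nat
  assumes "l = j \<or> l = Suc j" "i \<le> j + l" "i \<noteq> j" "i \<noteq> l"
  shows "(2::nat) ^ j + 2 ^ l < 2 ^ i + 2 ^ (j + l - i)"
proof -
  have *: "(2::nat) ^ j + 2 ^ l \<le> 2 ^ n" if "Suc l \<le> n" for n
  proof -
    have "(2::nat) ^ j \<le> 2 ^ l" using assms(1) by auto
    then have "(2::nat) ^ j + 2 ^ l \<le> 2 ^ Suc l" by simp
    also have "\<dots> \<le> 2 ^ n" using that by (intro power_increasing) auto
    finally show ?thesis .
  qed
  have "Suc l \<le> i \<or> Suc l \<le> j + l - i" using assms by auto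
  moreover have "(0::nat) < 2 ^ i" "(0::nat) < 2 ^ (j + l - i)" by simp_all
  ultimately show ?thesis
    using *[of i] *[of "j + l - i"] by linarith
qed

text \<open>
  Solving the derivative of \<open>x\<^sup>2\<close> of order \<open>j + l\<close> for its least spread term \<open>x\<^sub>j x\<^sub>l\<close>, \<open>l \<le> j + 1\<close>,
  keeps degree and weight but increases \<open>\<Sum> 2\<^sup>i\<close>, which is bounded in fixed degree and weight.
\<close>

lemma mono_reduce:
  "\<exists>q. (\<forall>n\<in>keys q. normal_mono n) \<and> single m 1 - q \<in> (x2_ideal :: 'k::field_char_0 dpoly set)"
proof (induction "wsum (\<lambda>_. 1) m * 2 ^ wsum id m - wsum (\<lambda>i. 2 ^ i) m" arbitrary: m rule: less_induct)
  case less
  show ?case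
  proof (cases "normal_mono m")
    case True
    then show ?thesis
      by (intro exI[of _ "single m 1"]) (auto simp: x2_ideal_0)
  next
    case False
    then obtain j l n where jl: "l = j \<or> l = Suc j" and m: "m = n + pair_mono j l"
      by (rule not_normal_mono)
    define r where "r = j + l"
    define mm where "mm = (\<lambda>i. n + pair_mono i (r - i))"
    define c where "c = (\<lambda>i. of_nat (r choose i) :: 'k)"
    \<comment> \<open>The terms of the r-th derivative other than x_j x_l. For j = l the set
      \<open>{j, l}\<close> is a singleton, so the middle term is counted once in
      \<open>c0\<close>.\<close>
    define J where "J = {..r} - {j, l}"
    have "\<exists>q. (\<forall>n\<in>keys q. normal_mono n) \<and> single (mm i) 1 - q \<in> (x2_ideal :: 'k dpoly set)"
      if i: "i \<in> J" for i
    proof (rule less)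
      have "wsum f (mm i) = wsum f n + f i + f (r - i)" "wsum f m = wsum f n + f j + f l" for f
        by (simp_all add: mm_def m pair_mono_def wsum_add del: One_nat_def)
      \<comment> \<open>Both monomials have the same ceiling. As \<open>mm i\<close> stays below it
        and has the larger exponential sum, the truncated difference drops strictly.\<close>
      moreover have "wsum (\<lambda>i. 2 ^ i) (mm i) \<le> wsum (\<lambda>_. 1) (mm i) * 2 ^ wsum id (mm i)"
        by (rule wsum_exp_bound)
      moreover have "(2::nat) ^ j + 2 ^ l < 2 ^ i + 2 ^ (r - i)"
        using two_powers_less[OF jl, of i] i by (auto simp: J_def r_def)
      moreover have "id i + id (r - i) = id j + id l" using i by (auto simp: J_def r_def)
      ultimately show "wsum (\<lambda>_. 1) (mm i) * 2 ^ wsum id (mm i) - wsum (\<lambda>i. 2 ^ i) (mm i)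
          < wsum (\<lambda>_. 1) m * 2 ^ wsum id m - wsum (\<lambda>i. 2 ^ i) m"
        by (simp add: add.assoc)
    qed
    then obtain q where q: "\<And>i n. i \<in> J \<Longrightarrow> n \<in> keys (q i) \<Longrightarrow> normal_mono n"
      "\<And>i. i \<in> J \<Longrightarrow> single (mm i) 1 - q i \<in> (x2_ideal :: 'k dpoly set)"
      by metis
    define c0 where "c0 = (\<Sum>i\<in>{j, l}. c i)"
    have "c0 = of_nat (\<Sum>i\<in>{j, l}. r choose i)" by (simp add: c0_def c_def)
    moreover have "(\<Sum>i\<in>{j, l}. r choose i) > 0"
      by (intro sum_pos) (auto simp: r_def)
    ultimately have c0: "c0 \<noteq> 0" by (metis of_nat_eq_0_iff less_numeral_extra(3))
    have mm: "mm i = m" if "i \<in> {j, l}" for i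
      using that by (auto simp: mm_def m r_def pair_mono_def add_ac)
    have "single n 1 * x2_deriv r = (\<Sum>i\<le>r. single (mm i) (c i))"
      by (simp add: x2_deriv_def sum_distrib_left mult_single mm_def c_def)
    also have "{..r} = {j, l} \<union> J" by (auto simp: J_def r_def)
    also have "(\<Sum>i\<in>{j, l} \<union> J. single (mm i) (c i)) =
        (\<Sum>i\<in>{j, l}. single (mm i) (c i)) + (\<Sum>i\<in>J. single (mm i) (c i))"
      by (intro sum.union_disjoint) (auto simp: J_def)
    also have "(\<Sum>i\<in>{j, l}. single (mm i) (c i)) = single m c0"
      unfolding c0_def single_sum by (intro sum.cong refl) (simp only: mm)
    finally have eq: "single n 1 * x2_deriv r = single m c0 + (\<Sum>i\<in>J. single (mm i) (c i))" .
    \<comment> \<open>Solve \<open>eq\<close> for the monomial m and replace each remaining monomial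
      by its normal form.\<close>
    define Q where "Q = - (\<Sum>i\<in>J. const (c i / c0) * q i)"
    have "\<forall>n\<in>keys Q. normal_mono n"
    proof
      fix n assume "n \<in> keys Q"
      then obtain i where "i \<in> J" "n \<in> keys (q i)"
        unfolding Q_def keys_uminus by (rule keys_lincomb)
      with q show "normal_mono n" by blast
    qed
    moreover have "single m 1 - Q = const (1 / c0) * (single n 1 * x2_deriv r) +
        - (\<Sum>i\<in>J. const (c i / c0) * (single (mm i) 1 - q i))"
      by (simp add: eq Q_def right_diff_distrib distrib_left const_mult_single sum_distrib_left
          sum_subtractf c0)
    then have "single m 1 - Q \<in> x2_ideal"
      using q by (simp only:) (intro x2_ideal_add x2_ideal_const x2_ideal_uminus x2_ideal_sum x2_ideal_mono x2_deriv_in)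
    ultimately show ?thesis by blast
  qed
qed

lemma dpoly_reduce:
  obtains q where "\<And>n. n \<in> keys q \<Longrightarrow> normal_mono n" "p - q \<in> (x2_ideal :: 'k::field_char_0 dpoly set)"
proof -
  obtain q where q: "\<And>m n. n \<in> keys (q m) \<Longrightarrow> normal_mono n"
    "\<And>m. single m 1 - q m \<in> (x2_ideal :: 'k dpoly set)"
    using mono_reduce by metis
  define Q where "Q = (\<Sum>m\<in>keys p. const (lookup p m) * q m)"
  show thesis
  proof (rule that[of Q])
    fix n assume "n \<in> keys Q"
    then obtain m where "n \<in> keys (q m)"
      unfolding Q_def by (rule keys_lincomb)
    with q show "normal_mono n" by blast
  next
    have "p - Q = (\<Sum>m\<in>keys p. const (lookup p m) * single m 1) - Q"
      by (simp add: const_mult_single poly_mapping_sum_single)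
    also have "\<dots> = (\<Sum>m\<in>keys p. const (lookup p m) * (single m 1 - q m))"
      by (simp add: Q_def sum_subtractf right_diff_distrib)
    finally show "p - Q \<in> x2_ideal"
      using q by (auto intro!: x2_ideal_sum x2_ideal_const)
  qed
qed

subsection \<open>Detection of normal monomials\<close>

definition weight_homog :: "('v \<Rightarrow> nat) \<Rightarrow> nat \<Rightarrow> (('v \<Rightarrow>\<^sub>0 nat) \<Rightarrow>\<^sub>0 'k::comm_ring_1) \<Rightarrow> bool" where
  "weight_homog h w p \<longleftrightarrow> (\<forall>M\<in>keys p. wsum h M = w)"

lemma weight_homog_mult:
  assumes "weight_homog h v p" "weight_homog h w q"
  shows "weight_homog h (v + w) (p * q)"
  unfolding weight_homog_def
proof
  fix M assume "M \<in> keys (p * q)"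
  then obtain m n where "M = m + n" "m \<in> keys p" "n \<in> keys q"
    using keys_mult[of p q] by blast
  then show "wsum h M = v + w"
    using assms by (simp add: weight_homog_def wsum_add)
qed

lemma weight_homog_one: "weight_homog h 0 1"
  by (simp add: weight_homog_def)

lemma weight_homog_power: "weight_homog h w p \<Longrightarrow> weight_homog h (n * w) (p ^ n)"
  by (induction n) (auto simp: weight_homog_one intro: weight_homog_mult)

lemma weight_homog_prod:
  "(\<And>i. i \<in> I \<Longrightarrow> weight_homog h (w i) (p i)) \<Longrightarrow> weight_homog h (\<Sum>i\<in>I. w i) (\<Prod>i\<in>I. p i)"
  by (induction I rule: infinite_finite_induct) (auto simp: weight_homog_one intro: weight_homog_mult)

lemma weight_homog_sum:
  assumes "\<And>i. i \<in> I \<Longrightarrow> weight_homog h w (p i)"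
  shows "weight_homog h w (\<Sum>i\<in>I. p i)"
  using assms
proof (induction I rule: infinite_finite_induct)
  case (insert i I)
  then show ?case
    using Poly_Mapping.keys_add[of "p i" "sum p I"] by (auto simp: weight_homog_def)
qed (auto simp: weight_homog_def)

lemma weight_homog_mono_eval:
  assumes "\<And>i. weight_homog h (w i) (F i)"
  shows "weight_homog h (wsum w m) (mono_eval F m)"
  unfolding mono_eval_def wsum_def by (intro weight_homog_prod weight_homog_power assms)

text \<open>
  The \<open>i\<close>-th derivative at \<open>t = c\<close> of \<open>\<Sum> e\<^sub>a\<^sub>b U\<^sub>a V\<^sub>b\<close> for \<open>U\<^sub>a = (t - c)\<^bsup>f(a)\<^esup>\<close>, \<open>V\<^sub>b = (t - c)\<^bsup>g(b)\<^esup>\<close>.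
\<close>

definition efield :: "nat set \<Rightarrow> (nat \<Rightarrow> nat) \<Rightarrow> (nat \<Rightarrow> nat) \<Rightarrow> nat \<Rightarrow> 'k::field_char_0 epoly" where
  "efield X f g i = (\<Sum>a\<in>X. \<Sum>b\<in>X. if f a + g b = i then single (single (a, b) 1) (fact i) else 0)"

text \<open>Only e_ab with f a + g b = i occur in \<open>efield X f g i\<close>. With this weight on
  e_ab, substitution carries the weight of a differential monomial over to its image.\<close>

lemma weight_homog_efield:
  assumes "\<And>a b. a \<in> X \<Longrightarrow> b \<in> X \<Longrightarrow> h' (a, b) = h (f a + g b)"
  shows "weight_homog h' (h i) (efield X f g i)"
  unfolding efield_def
  by (intro weight_homog_sum) (auto simp: weight_homog_def assms simp del: One_nat_def)

lemma efield_eval_support: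
  fixes p :: "'k::field_char_0 dpoly"
  assumes "M \<in> keys (escalar.eval (efield X f g) p)"
  shows "keys M \<subseteq> X \<times> X"
proof -
  \<comment> \<open>This weight counts the factors outside X x X; all the fields have weight
    0.\<close>
  let ?h = "\<lambda>k. if k \<in> X \<times> X then 0 else 1 :: nat"
  have *: "weight_homog ?h ((\<lambda>_. 0) i) (efield X f g i :: 'k epoly)" for i
    by (rule weight_homog_efield) auto
  have "weight_homog ?h 0 (single 0 c * mono_eval (efield X f g) m)" for c :: 'k and m
    using weight_homog_mult[of ?h 0 "single 0 c" "wsum (\<lambda>_. 0) m" "mono_eval (efield X f g) m"]
      weight_homog_mono_eval[OF *, of m]
    by (auto simp: weight_homog_def wsum_def)
  then have "weight_homog ?h 0 (escalar.eval (efield X f g) p)"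
    unfolding escalar.eval_def lin_ext_def by (intro weight_homog_sum)
  then have "wsum ?h M = 0" using assms by (simp add: weight_homog_def)
  then show ?thesis by (auto simp: wsum_def in_keys_iff split: if_splits)
qed

lemma omega_nonzero_graph:
  assumes "omega X F \<noteq> 0"
  obtains p where "p permutes X" "graph_mono X p \<in> keys F"
proof -
  obtain M where "M \<in> keys F" "lookup F M * graph_sign X M \<noteq> 0"
    using assms unfolding omega_def lin_ext_def by (meson sum.neutral)
  then have "graph_sign X M \<noteq> (0::'a)" by auto
  then obtain p where "p permutes X" "M = graph_mono X p"
    by (auto simp: graph_sign_def split: if_splits)
  with \<open>M \<in> keys F\<close> show thesis by (intro that[of p]) auto
qed

text \<open>As \<open>h\<close> is arbitrary, m is determined: its indices with multiplicity are the
  numbers f a + g (p a).\<close>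

lemma wsum_efield_graph:
  assumes "graph_mono X p \<in> keys (mono_eval (efield X f g :: nat \<Rightarrow> 'k::field_char_0 epoly) m)"
  shows "wsum h m = (\<Sum>a\<in>X. h (f a + g (p a)))"
proof -
  let ?h = "\<lambda>(a, b). h (f a + g b)"
  have *: "weight_homog ?h (h i) (efield X f g i :: 'k epoly)" for i
    by (rule weight_homog_efield) auto
  have "wsum ?h (graph_mono X p) = wsum h m"
    using weight_homog_mono_eval[of ?h h "efield X f g", OF *] assms by (auto simp: weight_homog_def)
  then show ?thesis
    by (simp add: graph_mono_def wsum_sum del: One_nat_def)
qed

text \<open>Let a0 be the largest point moved by p. Above a0 nothing changes. Up to a0, monotonicity
  puts every permuted exponent below f a0 + g a0, and since the base exceeds the number of terms,
  they sum to less than the single power at a0.\<close>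

lemma sum_powers_permuted_less:
  fixes f g :: "nat \<Rightarrow> nat"
  assumes X: "finite X" and f: "strict_mono_on X f" and g: "strict_mono_on X g"
    and p: "p permutes X" "p \<noteq> id"
  shows "(\<Sum>a\<in>X. Suc (card X) ^ (f a + g (p a))) < (\<Sum>a\<in>X. Suc (card X) ^ (f a + g a))"
proof -
  let ?B = "Suc (card X)"
  define S where "S = {a \<in> X. p a \<noteq> a}"
  have "S \<noteq> {}" using p by (auto simp: S_def fun_eq_iff dest: permutes_not_in)
  have "finite S" using X by (simp add: S_def)
  define a0 where "a0 = Max S"
  have a0: "a0 \<in> X" "p a0 \<noteq> a0"
    using Max_in[OF \<open>finite S\<close> \<open>S \<noteq> {}\<close>] by (auto simp: S_def a0_def)
  have fixed: "p a = a" if "a > a0" for a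
    using Max_ge[OF \<open>finite S\<close>, of a] that p(1) by (fastforce simp: S_def a0_def permutes_not_in)
  have pX: "p a \<in> X" if "a \<in> X" for a using p(1) that by (simp add: permutes_in_image)
  have le: "p a \<le> a0" if "a \<le> a0" for a
  proof (rule ccontr)
    assume "\<not> p a \<le> a0"
    then have "p (p a) = p a" by (intro fixed) simp
    then have "p a = a" using permutes_inj[OF p(1)] by (meson injD)
    then show False using \<open>\<not> p a \<le> a0\<close> that by simp
  qed
  have lt: "f a + g (p a) < f a0 + g a0" if "a \<in> X" "a \<le> a0" for a
  proof (cases "a = a0")
    case True
    then have "p a < a0" using le[OF that(2)] a0 by auto
    then show ?thesis using strict_mono_onD[OF g, of "p a" a0] pX a0 that True by simp
  next
    case False
    then have "f a < f a0" using strict_mono_onD[OF f, of a a0] that a0 by auto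
    moreover have "g (p a) \<le> g a0"
      using strict_mono_onD[OF g, of "p a" a0] le[OF that(2)] pX that a0 by (cases "p a = a0") auto
    ultimately show ?thesis by simp
  qed
  define Y where "Y = {a \<in> X. a \<le> a0}"
  have Y: "finite Y" "Y \<subseteq> X" "a0 \<in> Y" using X a0 by (auto simp: Y_def)
  have "?B * (\<Sum>a\<in>Y. ?B ^ (f a + g (p a))) = (\<Sum>a\<in>Y. ?B ^ Suc (f a + g (p a)))"
    by (simp only: sum_distrib_left power_Suc)
  also have "\<dots> \<le> (\<Sum>a\<in>Y. ?B ^ (f a0 + g a0))"
    using lt by (intro sum_mono power_increasing) (auto simp: Y_def Suc_le_eq)
  also have "\<dots> \<le> card X * ?B ^ (f a0 + g a0)"
    using card_mono[OF X Y(2)] by simp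
  also have "\<dots> < ?B * ?B ^ (f a0 + g a0)" by simp
  finally have "(\<Sum>a\<in>Y. ?B ^ (f a + g (p a))) < ?B ^ (f a0 + g a0)"
    by (simp only: nat_mult_less_cancel1 zero_less_Suc)
  also have "\<dots> \<le> (\<Sum>a\<in>Y. ?B ^ (f a + g a))"
    using Y by (intro member_le_sum) auto
  finally have "(\<Sum>a\<in>Y. ?B ^ (f a + g (p a))) < (\<Sum>a\<in>Y. ?B ^ (f a + g a))" .
  moreover have "(\<Sum>a\<in>X - Y. ?B ^ (f a + g (p a))) = (\<Sum>a\<in>X - Y. ?B ^ (f a + g a))"
    using fixed by (intro sum.cong) (auto simp: Y_def)
  ultimately show ?thesis
    unfolding sum.subset_diff[OF Y(2) X] by linarith
qed

text \<open>Membership in the ideal generated by the e_bc with b \<noteq> c. Modulo this ideal a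
  product of fields reduces to its diagonal part.\<close>

definition off_diag :: "'k::comm_ring_1 epoly \<Rightarrow> bool" where
  "off_diag p \<longleftrightarrow> (\<forall>M\<in>keys p. \<exists>(b, c)\<in>keys M. b \<noteq> c)"

lemma off_diag_lookup:
  assumes "off_diag p" "\<And>b c. (b, c) \<in> keys M \<Longrightarrow> b = c"
  shows "lookup p M = 0"
proof (rule ccontr)
  assume "lookup p M \<noteq> 0"
  then have "M \<in> keys p" by (simp add: in_keys_iff)
  with assms show False unfolding off_diag_def by blast
qed

lemma off_diag_add: "off_diag p \<Longrightarrow> off_diag q \<Longrightarrow> off_diag (p + q)"
  using Poly_Mapping.keys_add[of p q] unfolding off_diag_def by blast

lemma off_diag_sum: "(\<And>i. i \<in> I \<Longrightarrow> off_diag (p i)) \<Longrightarrow> off_diag (sum p I)"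
  by (induction I rule: infinite_finite_induct) (auto intro: off_diag_add, auto simp: off_diag_def)

lemma off_diag_mult:
  assumes "off_diag p" shows "off_diag (p * q)"
  unfolding off_diag_def
proof
  fix M assume "M \<in> keys (p * q)"
  then obtain m n where M: "M = m + n" "m \<in> keys p"
    using keys_mult[of p q] by blast
  then obtain b c where "(b, c) \<in> keys m" "b \<noteq> c"
    using assms by (auto simp: off_diag_def)
  then have "(b, c) \<in> keys M" "b \<noteq> c"
    by (simp_all add: M in_keys_iff lookup_add)
  then show "\<exists>(b, c)\<in>keys M. b \<noteq> c" by blast
qed

lemma off_diag_prod:
  assumes "finite I" "\<And>i. i \<in> I \<Longrightarrow> off_diag (p i - q i)"
  shows "off_diag (prod p I - prod q I)"
  using assms
proof (induction I rule: finite_induct)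
  case (insert i I)
  have "prod p (insert i I) - prod q (insert i I) = (p i - q i) * prod p I + (prod p I - prod q I) * q i"
    using insert by (simp add: algebra_simps)
  then show ?case using insert by (auto intro: off_diag_add off_diag_mult)
qed (simp add: off_diag_def)

lemma prod_single: "(\<Prod>i\<in>I. single (m i) (c i)) = single (\<Sum>i\<in>I. m i) (\<Prod>i\<in>I. c i :: 'k::comm_ring_1)"
  for m :: "'i \<Rightarrow> 'm::comm_monoid_add"
  by (induction I rule: infinite_finite_induct) (auto simp: mult_single)

text \<open>f + g is injective on X, so e_aa is the only diagonal variable in the field of index f a
  + g a. Modulo \<open>off_diag\<close> the product is thus a multiple of the graph monomial of the
  identity.\<close>

lemma lookup_prod_efield_diag:
  fixes f g :: "nat \<Rightarrow> nat"
  assumes X: "finite X" and f: "strict_mono_on X f" and g: "strict_mono_on X g"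
  shows "lookup (\<Prod>a\<in>X. efield X f g (f a + g a)) (graph_mono X id) = (\<Prod>a\<in>X. fact (f a + g a) :: 'k::field_char_0)"
proof -
  have inj: "b = a" if "a \<in> X" "b \<in> X" "f b + g b = f a + g a" for a b
    using that strict_mono_onD[OF f, of a b] strict_mono_onD[OF f, of b a]
      strict_mono_onD[OF g, of a b] strict_mono_onD[OF g, of b a]
    by (cases a b rule: linorder_cases) auto
  let ?d = "\<lambda>a. single (single (a, a) 1) (fact (f a + g a)) :: 'k epoly"
  have "off_diag (efield X f g (f a + g a) - ?d a)" if a: "a \<in> X" for a
  proof -
    let ?t = "\<lambda>b c. if f b + g c = f a + g a then single (single (b, c) 1) (fact (f a + g a)) else 0 :: 'k epoly"
    have "?d a = (\<Sum>b\<in>X. \<Sum>c\<in>X. if b = a \<and> c = a then ?d a else 0)"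
    proof -
      have "(\<Sum>c\<in>X. if b = a \<and> c = a then ?d a else 0) = (if b = a then ?d a else 0)" for b
        using a X by (cases "b = a") auto
      then show ?thesis using a X by simp
    qed
    then have "efield X f g (f a + g a) - ?d a =
        (\<Sum>b\<in>X. \<Sum>c\<in>X. ?t b c - (if b = a \<and> c = a then ?d a else 0))"
      unfolding efield_def by (simp only: sum_subtractf)
    moreover have "off_diag (?t b c - (if b = a \<and> c = a then ?d a else 0))" if "b \<in> X" "c \<in> X" for b c
    proof (cases "b = c")
      case True
      then have "?t b c - (if b = a \<and> c = a then ?d a else 0) = 0"
        using inj[OF a that(1)] by auto
      then show ?thesis by (simp add: off_diag_def)
    qed (auto simp: off_diag_def)
    ultimately show ?thesis by (auto intro!: off_diag_sum)
  qed
  then have "off_diag ((\<Prod>a\<in>X. efield X f g (f a + g a)) - (\<Prod>a\<in>X. ?d a))"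
    by (intro off_diag_prod X)
  moreover have "b = c" if "(b, c) \<in> keys (graph_mono X id)" for b c
    using X that by (auto simp: in_keys_iff lookup_graph_mono split: if_splits)
  ultimately have "lookup ((\<Prod>a\<in>X. efield X f g (f a + g a)) - (\<Prod>a\<in>X. ?d a)) (graph_mono X id) = 0"
    by (rule off_diag_lookup)
  moreover have "(\<Prod>a\<in>X. ?d a) = single (graph_mono X id) (\<Prod>a\<in>X. fact (f a + g a))"
    unfolding prod_single by (simp add: graph_mono_def)
  ultimately show ?thesis by (simp add: lookup_minus)
qed

text \<open>The graph of some p \<noteq> id in the image of m would have the same sum of powers as
  the identity, against the strict inequality. Only the identity contributes, with a product of
  factorials.\<close>

lemma omega_efield_diag:
  fixes f g :: "nat \<Rightarrow> nat"
  assumes X: "finite X" and f: "strict_mono_on X f" and g: "strict_mono_on X g"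
    and m: "m = (\<Sum>a\<in>X. single (f a + g a) 1)"
  shows "omega X (mono_eval (efield X f g :: nat \<Rightarrow> 'k::field_char_0 epoly) m) \<noteq> 0"
proof -
  let ?F = "mono_eval (efield X f g :: nat \<Rightarrow> 'k epoly) m"
  have F: "?F = (\<Prod>a\<in>X. efield X f g (f a + g a))"
    unfolding m mono_eval_sum mono_eval_single ..
  have L: "lookup ?F (graph_mono X id) = (\<Prod>a\<in>X. fact (f a + g a))"
    unfolding F by (rule lookup_prod_efield_diag[OF X f g])
  then have nz: "lookup ?F (graph_mono X id) \<noteq> 0"
    using X by simp
  have "lookup ?F M * graph_sign X M = 0" if "M \<in> keys ?F" "M \<noteq> graph_mono X id" for M
  proof (rule ccontr)
    assume "lookup ?F M * graph_sign X M \<noteq> 0"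
    then obtain p where p: "p permutes X" "M = graph_mono X p"
      by (auto simp: graph_sign_def split: if_splits)
    then have "p \<noteq> id" using that by auto
    have "wsum (\<lambda>i. Suc (card X) ^ i) m = (\<Sum>a\<in>X. Suc (card X) ^ (f a + g (p a)))"
      using that p by (intro wsum_efield_graph) auto
    moreover have "wsum (\<lambda>i. Suc (card X) ^ i) m = (\<Sum>a\<in>X. Suc (card X) ^ (f a + g a))"
      unfolding m wsum_sum wsum_single ..
    ultimately show False
      using sum_powers_permuted_less[OF X f g p(1) \<open>p \<noteq> id\<close>] by simp
  qed
  then have "omega X ?F = (\<Sum>M\<in>{graph_mono X id}. lookup ?F M * graph_sign X M)"
    unfolding omega_def lin_ext_def using nz by (intro sum.mono_neutral_right) (auto simp: in_keys_iff)
  also have "\<dots> = lookup ?F (graph_mono X id)"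
    by (simp add: graph_sign_graph_mono[OF X permutes_id])
  finally show ?thesis using nz by simp
qed

text \<open>Consecutive indices differ by at least 2, so the j-th index minus j still increases
  strictly. The offset s allows disjoint index blocks for two monomials.\<close>

lemma normal_mono_enumeration:
  assumes "normal_mono m"
  obtains n g where "strict_mono_on {s..<s + n} g" "m = (\<Sum>a\<in>{s..<s + n}. single (a - s + g a) 1)"
proof -
  define n where "n = card (keys m)"
  obtain h where h: "bij_betw h {..<n} (keys m)" "strict_mono_on {..<n} h"
    unfolding n_def by (rule ex_bij_betw_strict_mono_card[of "keys m", OF finite_keys])
  have hm: "lookup m (h j) \<ge> 1" if "j < n" for j
    using h(1) that by (force simp: bij_betw_def in_keys_iff Suc_le_eq)
  have step: "h j + 2 \<le> h (Suc j)" if "Suc j < n" for j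
  proof -
    have "h j < h (Suc j)" using strict_mono_onD[OF h(2), of j "Suc j"] that by simp
    moreover have "h (Suc j) \<noteq> Suc (h j)"
      using assms[unfolded normal_mono_def, rule_format, of "h j"] hm[of j] hm[of "Suc j"] that by auto
    ultimately show ?thesis by simp
  qed
  have gap: "h j + 2 * d \<le> h (j + d)" if "j + d < n" for j d
    using that by (induction d) (use step in force)+
  define g where "g = (\<lambda>a. h (a - s) - (a - s))"
  have le: "j \<le> h j" if "j < n" for j
    using gap[of 0 j] that by simp
  show thesis
  proof (rule that)
    show "strict_mono_on {s..<s + n} g"
    proof (rule strict_mono_onI)
      fix a b assume ab: "a \<in> {s..<s + n}" "b \<in> {s..<s + n}" "a < b"
      then have "h (a - s) + 2 * (b - a) \<le> h (b - s)"
        using gap[of "a - s" "b - a"] by auto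
      moreover have "a - s \<le> h (a - s)" using le ab by auto
      ultimately show "g a < g b" using ab by (auto simp: g_def)
    qed
    have "m = (\<Sum>i\<in>keys m. single i (lookup m i))"
      by (simp add: poly_mapping_sum_single)
    also have "\<dots> = (\<Sum>i\<in>keys m. single i 1)"
    proof (intro sum.cong refl)
      fix i assume "i \<in> keys m"
      then have "lookup m i = 1"
        using assms[unfolded normal_mono_def, rule_format, of i] by (auto simp: in_keys_iff)
      then show "single i (lookup m i) = single i 1" by simp
    qed
    also have "\<dots> = (\<Sum>j\<in>{..<n}. single (h j) 1)"
      using h(1) by (rule sum.reindex_bij_betw[symmetric])
    also have "\<dots> = (\<Sum>a\<in>{s..<s + n}. single (h (a - s)) 1)"
      by (rule sum.reindex_bij_witness[of _ "\<lambda>a. a - s" "\<lambda>j. j + s"]) auto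
    also have "\<dots> = (\<Sum>a\<in>{s..<s + n}. single (a - s + g a) 1)"
    proof (intro sum.cong refl)
      fix a assume "a \<in> {s..<s + n}"
      then have "a - s \<le> h (a - s)" by (intro le) auto
      then have "a - s + g a = h (a - s)" unfolding g_def by (rule le_add_diff_inverse)
      then show "single (h (a - s)) 1 = single (a - s + g a) (1::nat)" by simp
    qed
    finally show "m = (\<Sum>a\<in>{s..<s + n}. single (a - s + g a) 1)" .
  qed
qed

lemma poly_mapping_eq_wsum:
  fixes m n :: "'v \<Rightarrow>\<^sub>0 nat"
  assumes "\<And>h. wsum h m = wsum h n" shows "m = n"
proof (rule poly_mapping_eqI)
  fix i
  have *: "wsum (\<lambda>j. if j = i then 1 else 0) x = lookup x i" for x :: "'v \<Rightarrow>\<^sub>0 nat"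
    by (simp add: wsum_def in_keys_iff if_distrib cong: if_cong)
  show "lookup m i = lookup n i" using assms[of "\<lambda>j. if j = i then 1 else 0"] by (simp add: *)
qed

text \<open>Among the monomials of q of one degree N, take m with the smallest sum of powers. A
  graph of p in the image of another m' forces degree N = card X; then p = id gives m' = m, and p
  \<noteq> id makes the sum of m' smaller than that of m.\<close>

lemma normal_detect:
  fixes q :: "'k::field_char_0 dpoly"
  assumes normal: "\<And>m. m \<in> keys q \<Longrightarrow> normal_mono m" and "q \<noteq> 0"
  obtains n g where "omega {s..<s + n} (escalar.eval (efield {s..<s + n} (\<lambda>a. a - s) g) q) \<noteq> 0"
proof -
  from \<open>q \<noteq> 0\<close> obtain m0 where m0: "m0 \<in> keys q" by (metis all_not_in_conv keys_eq_empty)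
  define N where "N = wsum (\<lambda>_. 1) m0"
  define K where "K = {m \<in> keys q. wsum (\<lambda>_. 1) m = N}"
  let ?Q = "wsum (\<lambda>i. Suc N ^ i)"
  have "finite K" "K \<noteq> {}" using m0 by (auto simp: K_def N_def)
  then obtain m where m: "m \<in> K" and min: "\<And>m'. m' \<in> K \<Longrightarrow> ?Q m \<le> ?Q m'"
    using arg_min_if_finite[of K ?Q] by (metis not_less)
  obtain n g where g: "strict_mono_on {s..<s + n} g" and m_eq: "m = (\<Sum>a\<in>{s..<s + n}. single (a - s + g a) 1)"
    using normal_mono_enumeration[of m s] normal m by (auto simp: K_def)
  define X where "X = {s..<s + n}"
  define f where "f = (\<lambda>a. a - s)"
  have f: "strict_mono_on X f" by (auto simp: X_def f_def intro!: strict_mono_onI)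
  have X: "finite X" by (simp add: X_def)
  note g = g[folded X_def]
  have m_eq: "m = (\<Sum>a\<in>X. single (f a + g a) 1)" unfolding m_eq X_def f_def ..
  have "wsum (\<lambda>_. 1) m = card X" unfolding m_eq wsum_sum wsum_single by simp
  then have N: "N = card X" using m by (simp add: K_def)
  let ?F = "efield X f g :: nat \<Rightarrow> 'k epoly"
  have "omega X (mono_eval ?F m') = 0" if m': "m' \<in> keys q" "m' \<noteq> m" for m'
  proof (rule ccontr)
    assume "omega X (mono_eval ?F m') \<noteq> 0"
    then obtain p where p: "p permutes X" "graph_mono X p \<in> keys (mono_eval ?F m')"
      by (rule omega_nonzero_graph)
    have w: "wsum h m' = (\<Sum>a\<in>X. h (f a + g (p a)))" for h
      using p(2) by (rule wsum_efield_graph)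
    have "m' \<in> K" using w[of "\<lambda>_. 1"] m'(1) by (simp add: K_def N)
    show False
    proof (cases "p = id")
      case True
      have "m' = m"
        by (rule poly_mapping_eq_wsum) (simp add: w True m_eq wsum_sum del: One_nat_def)
      with m' show False by simp
    next
      case False
      have "?Q m' < ?Q m"
        using sum_powers_permuted_less[OF X f g p(1) False]
        by (simp add: w m_eq wsum_sum N del: One_nat_def)
      with min[OF \<open>m' \<in> K\<close>] show False by simp
    qed
  qed
  then have "omega X (escalar.eval ?F q) = (\<Sum>m'\<in>{m}. lookup q m' * omega X (mono_eval ?F m'))"
    unfolding escalar.eval_def lin_ext_def omega_sum omega_scale
    using m by (intro sum.mono_neutral_right) (auto simp: K_def)
  moreover have "lookup q m \<noteq> 0" using m by (simp add: K_def in_keys_iff)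
  ultimately have "omega X (escalar.eval ?F q) \<noteq> 0"
    using omega_efield_diag[OF X f g m_eq, where 'k='k] by simp
  then show thesis by (intro that) (simp add: X_def f_def)
qed

subsection \<open>Localization at two points\<close>

lemma higher_pderiv_vanishes:
  fixes p :: "'r::idom poly"
  assumes "[:- c, 1:] ^ K dvd p" "i < K"
  shows "poly ((pderiv ^^ i) p) c = 0"
  using assms
proof (induction i arbitrary: K p)
  case 0
  then have "[:- c, 1:] dvd p" by (metis dvd_power dvd_trans)
  then show ?case by (simp add: poly_eq_0_iff_dvd)
next
  case (Suc i)
  then obtain q where p: "p = [:- c, 1:] ^ K * q" by (elim dvdE)
  obtain k where K: "K = Suc k" using Suc.prems by (cases K) auto
  have "pderiv p = [:- c, 1:] ^ k * ([:- c, 1:] * pderiv q + q * [:of_nat K:])"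
    by (simp add: p K pderiv_mult pderiv_power_Suc pderiv_pCons algebra_simps del: power_Suc)
      (simp add: algebra_simps)
  then have "[:- c, 1:] ^ k dvd pderiv p" by (metis dvd_triv_left)
  with Suc.prems K show ?case by (simp only: funpow_Suc_right o_def) (intro Suc.IH, auto)
qed

lemma higher_pderiv_power_at:
  "poly ((pderiv ^^ i) ([:- c, 1:] ^ n)) c = (if i = n then fact i else (0::'r::{idom,ring_char_0}))"
proof (induction i arbitrary: n)
  case 0
  then show ?case by (cases n) auto
next
  case (Suc i)
  have "pderiv ([:- c, 1:] ^ n) = smult (of_nat n) ([:- c, 1:] ^ (n - 1))"
    by (simp add: pderiv_power pderiv_pCons)
  then have "poly ((pderiv ^^ Suc i) ([:- c, 1:] ^ n)) c =
      of_nat n * poly ((pderiv ^^ i) ([:- c, 1:] ^ (n - 1))) c"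
    by (simp only: funpow_Suc_right o_def higher_pderiv_smult poly_smult)
  also have "\<dots> = (if Suc i = n then fact (Suc i) else 0)"
    unfolding Suc.IH by (cases n) auto
  finally show ?case .
qed

lemma comaximal_power:
  fixes x y :: "'r::comm_ring_1"
  assumes "x * P + y * Q = 1"
  obtains P' Q' where "x ^ m * P' + y * Q' = 1"
proof -
  have "\<exists>P' Q'. x ^ m * P' + y * Q' = 1"
  proof (induction m)
    case 0
    show ?case by (rule exI[of _ 1], rule exI[of _ 0]) simp
  next
    case (Suc m)
    then obtain P' Q' where eq: "x ^ m * P' + y * Q' = 1" by blast
    \<comment> \<open>The witnesses arise by inserting the factor \<open>x * P + y * Q\<close>,
      which is 1, into the first summand.\<close>
    have "x ^ Suc m * (P' * P) + y * (x ^ m * P' * Q + Q') = x ^ m * P' * (x * P + y * Q) + y * Q'"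
      by (simp add: algebra_simps)
    also have "\<dots> = 1" using eq by (simp add: assms)
    finally show ?case by blast
  qed
  then show thesis using that by blast
qed

text \<open>E^2 = 1 - (1 - E)(1 + E) agrees with 1 to order K at c, so derivatives of order below K
  do not see E.\<close>

lemma higher_pderiv_localized:
  fixes E :: "'r::{idom,ring_char_0} poly"
  assumes "[:- c, 1:] ^ K dvd 1 - E" "i < K"
  shows "poly ((pderiv ^^ i) (E * [:- c, 1:] ^ j * (E * [:- c, 1:] ^ k))) c =
    (if j + k = i then fact i else 0)"
proof -
  let ?L = "[:- c, 1:]"
  have "E * ?L ^ j * (E * ?L ^ k) = ?L ^ (j + k) + (1 - E) * (- (1 + E) * ?L ^ (j + k))"
    by (simp add: power_add algebra_simps)
  moreover have "poly ((pderiv ^^ i) ((1 - E) * (- (1 + E) * ?L ^ (j + k)))) c = 0"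
    using assms by (intro higher_pderiv_vanishes[of c K]) auto
  ultimately show ?thesis
    by (auto simp: higher_pderiv_add higher_pderiv_power_at)
qed

text \<open>A product with an index outside X vanishes to order K at c, and K exceeds every order of
  derivative that p involves. So only the block X survives.\<close>

lemma poly_theta_localized:
  fixes p :: "'k::field_char_0 dpoly"
  assumes Z: "finite Z" "X \<subseteq> Z" and E: "[:- c, 1:] ^ K dvd 1 - E"
    and UV: "\<And>a. a \<in> X \<Longrightarrow> U a = E * [:- c, 1:] ^ f a" "\<And>a. a \<in> X \<Longrightarrow> V a = E * [:- c, 1:] ^ g a"
    and out: "\<And>a. a \<in> Z - X \<Longrightarrow> [:- c, 1:] ^ K dvd U a" "\<And>a. a \<in> Z - X \<Longrightarrow> [:- c, 1:] ^ K dvd V a"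
    and K: "\<And>m i. m \<in> keys p \<Longrightarrow> i \<in> keys m \<Longrightarrow> i < K"
  shows "poly (theta Z U V p) c = escalar.eval (efield X f g) p"
  unfolding poly_theta
proof (rule escalar.eval_cong)
  fix m i assume "m \<in> keys p" "i \<in> keys m"
  then have i: "i < K" by (rule K)
  let ?t = "\<lambda>a b. evar a b * poly ((pderiv ^^ i) (U a * V b)) c"
  have 0: "?t a b = 0" if "a \<in> Z" "b \<in> Z" "a \<notin> X \<or> b \<notin> X" for a b
    using that out i by (subst higher_pderiv_vanishes[of c K]) (auto intro: dvd_mult dvd_mult2)
  have "(\<Sum>a\<in>Z. \<Sum>b\<in>Z. ?t a b) = (\<Sum>a\<in>X. \<Sum>b\<in>Z. ?t a b)"
    using Z 0 by (intro sum.mono_neutral_right) (auto intro!: sum.neutral)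
  also have "\<dots> = (\<Sum>a\<in>X. \<Sum>b\<in>X. ?t a b)"
    using Z 0 by (intro sum.cong refl sum.mono_neutral_right) auto
  also have "\<dots> = efield X f g i"
    unfolding efield_def
  proof (intro sum.cong refl)
    fix a b assume ab: "a \<in> X" "b \<in> X"
    have "(fact i :: 'k epoly) = single 0 (fact i)"
      by (metis of_nat_fact single_of_nat)
    then have "evar a b * fact i = single (single (a, b) 1) (fact i :: 'k)"
      by (simp add: evar_def mult_single)
    then show "?t a b = (if f a + g b = i then single (single (a, b) 1) (fact i) else 0)"
      by (simp only: UV ab higher_pderiv_localized[OF E i] split: if_split) simp
  qed
  finally show "(\<Sum>a\<in>Z. \<Sum>b\<in>Z. ?t a b) = efield X f g i" .
qed

lemma dpoly_var_bound:
  fixes p :: "'k::zero dpoly"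
  obtains K where "\<And>m i. m \<in> keys p \<Longrightarrow> i \<in> keys m \<Longrightarrow> i < K"
proof -
  have "finite (\<Union>m\<in>keys p. keys m)" by simp
  then obtain K where "\<forall>i\<in>(\<Union>m\<in>keys p. keys m). i < K"
    using finite_nat_set_iff_bounded by blast
  then show thesis by (intro that) blast
qed

lemma normal_product_not_in_x2_ideal:
  fixes p q :: "'k::field_char_0 dpoly"
  assumes p: "\<And>m. m \<in> keys p \<Longrightarrow> normal_mono m" "p \<noteq> 0"
    and q: "\<And>m. m \<in> keys q \<Longrightarrow> normal_mono m" "q \<noteq> 0"
  shows "\<exists>i. (deriv ^^ i) p * q \<notin> x2_ideal"
proof (rule ccontr)
  assume "\<nexists>i. (deriv ^^ i) p * q \<notin> x2_ideal"
  then have prod: "(deriv ^^ i) p * q \<in> x2_ideal" for i by blast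
  \<comment> \<open>The offsets 0 and n give p and q disjoint index blocks.\<close>
  obtain n g where g: "omega {0..<0 + n} (escalar.eval (efield {0..<0 + n} (\<lambda>a. a - 0) g) p) \<noteq> 0"
    using normal_detect[OF p] by blast
  obtain k h where h: "omega {n..<n + k} (escalar.eval (efield {n..<n + k} (\<lambda>a. a - n) h) q) \<noteq> 0"
    using normal_detect[OF q] by blast
  define X where "X = {0..<n}"
  define Y where "Y = {n..<n + k}"
  define Z where "Z = X \<union> Y"
  have Z: "finite Z" "X \<subseteq> Z" "Y \<subseteq> Z" by (auto simp: Z_def X_def Y_def)
  obtain K1 where K1: "\<And>m i. m \<in> keys p \<Longrightarrow> i \<in> keys m \<Longrightarrow> i < K1"
    using dpoly_var_bound[of p] by blast
  obtain K2 where K2: "\<And>m i. m \<in> keys q \<Longrightarrow> i \<in> keys m \<Longrightarrow> i < K2"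
    using dpoly_var_bound[of q] by blast
  define K where "K = max K1 K2"
  have K: "i < K" if "m \<in> keys p \<union> keys q" "i \<in> keys m" for m i
    using that K1[of m i] K2[of m i] by (auto simp: K_def)
  let ?L0 = "[:- 0, 1:] :: 'k epoly poly" and ?L1 = "[:- 1, 1:] :: 'k epoly poly"
  \<comment> \<open>From t - (t - 1) = 1, both factors are raised to the power K one after the
    other.\<close>
  have "?L0 * 1 + ?L1 * (- 1) = 1" by (simp add: one_pCons)
  then obtain P Q where "?L0 ^ K * P + ?L1 * Q = 1" by (rule comaximal_power)
  then have "?L1 * Q + ?L0 ^ K * P = 1" by (simp only: add.commute)
  then obtain Q' P' where PQ: "?L1 ^ K * Q' + (?L0 ^ K) * P' = 1" by (rule comaximal_power)
  \<comment> \<open>E0 equals 1 to order K at 0 and vanishes to order K at 1; E1 behaves the other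
    way round.\<close>
  define E0 where "E0 = ?L1 ^ K * Q'"
  define E1 where "E1 = ?L0 ^ K * P'"
  have E: "1 - E0 = E1" "1 - E1 = E0" using PQ by (simp_all add: E0_def E1_def algebra_simps)
  have dvd: "?L1 ^ K dvd E0" "?L0 ^ K dvd E1" by (simp_all add: E0_def E1_def)
  \<comment> \<open>Block X is concentrated at t = 1 and block Y at t = 0, so evaluating at a point
    selects one block.\<close>
  define U where "U = (\<lambda>a. if a < n then E1 * ?L1 ^ a else E0 * ?L0 ^ (a - n))"
  define V where "V = (\<lambda>a. if a < n then E1 * ?L1 ^ g a else E0 * ?L0 ^ h a)"
  have "(pderiv ^^ i) (theta Z U V p) * theta Z U V q \<in> annih Z" for i
    using theta_x2_ideal[OF Z(1) prod[of i], of U V]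
    by (simp only: theta_def poly_scalar.eval_mult) (simp only: theta_funpow_deriv flip: theta_def)
  then have "omega Z (poly (theta Z U V p) 1 * poly (theta Z U V q) 0) = 0"
    unfolding poly_0_coeff_0 by (rule omega_taylor)
  also have "poly (theta Z U V p) 1 = escalar.eval (efield X (\<lambda>a. a) g) p"
    by (rule poly_theta_localized[OF Z(1,2), of 1 K E1])
      (use K dvd in \<open>auto simp: E U_def V_def X_def Z_def Y_def\<close>)
  also have "poly (theta Z U V q) 0 = escalar.eval (efield Y (\<lambda>a. a - n) h) q"
    by (rule poly_theta_localized[OF Z(1,3), of 0 K E0])
      (use K dvd in \<open>auto simp: E U_def V_def X_def Z_def Y_def\<close>)
  also have "omega Z (escalar.eval (efield X (\<lambda>a. a) g) p * escalar.eval (efield Y (\<lambda>a. a - n) h) q) =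
      omega X (escalar.eval (efield X (\<lambda>a. a) g) p) * omega Y (escalar.eval (efield Y (\<lambda>a. a - n) h) q)"
    unfolding Z_def by (rule omega_mult_disjoint)
      (auto simp: X_def Y_def dest: efield_eval_support[THEN subsetD])
  finally show False using g h by (simp add: X_def Y_def)
qed

section \<open>Passage to ideals\<close>

lemma diff_ideal_funpow_deriv: "diff_ideal A \<Longrightarrow> a \<in> A \<Longrightarrow> (deriv ^^ i) a \<in> A"
  by (induction i) (auto simp: diff_ideal_def)

text \<open>Reducing an element of A outside [x^2] changes it only by an element of [x^2], which
  lies in A; the result is nonzero because the original is not in [x^2].\<close>

lemma normal_representative:
  fixes A :: "'k::field_char_0 dpoly set"
  assumes "diff_ideal A" "x2_ideal \<subseteq> A" "\<not> A \<subseteq> x2_ideal"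
  obtains q where "q \<in> A" "q \<noteq> 0" "\<And>m. m \<in> keys q \<Longrightarrow> normal_mono m"
proof -
  obtain a where a: "a \<in> A" "a \<notin> x2_ideal" using assms by blast
  obtain q where q: "\<And>m. m \<in> keys q \<Longrightarrow> normal_mono m" "a - q \<in> x2_ideal"
    using dpoly_reduce[of a] by blast
  have "q = a + - (a - q)" by simp
  moreover have "- (a - q) \<in> A" using assms(2) x2_ideal_uminus[OF q(2)] by blast
  ultimately have "q \<in> A" using assms(1) a(1) unfolding diff_ideal_def by metis
  moreover have "q \<noteq> 0" using a q by auto
  ultimately show thesis using q by (intro that)
qed

text \<open>Nonzero differential ideals of D_2 are represented by their preimages, the differential
  ideals properly containing [x^2]. That AB is nonzero means that some product of representatives
  lies outside [x^2].\<close>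

theorem theorem1:
  fixes A B :: "'k::field_char_0 dpoly set"
  assumes "diff_ideal A" and "x2_ideal \<subseteq> A" and "\<not> A \<subseteq> x2_ideal"
      and "diff_ideal B" and "x2_ideal \<subseteq> B" and "\<not> B \<subseteq> x2_ideal"
  shows "\<exists>a\<in>A. \<exists>b\<in>B. a * b \<notin> (x2_ideal :: 'k dpoly set)"
proof -
  obtain p where p: "p \<in> A" "p \<noteq> 0" "\<And>m. m \<in> keys p \<Longrightarrow> normal_mono m"
    using normal_representative[OF assms(1-3)] by blast
  obtain q where q: "q \<in> B" "q \<noteq> 0" "\<And>m. m \<in> keys q \<Longrightarrow> normal_mono m"
    using normal_representative[OF assms(4-6)] by blast
  obtain i where "(deriv ^^ i) p * q \<notin> x2_ideal"
    using normal_product_not_in_x2_ideal[OF p(3,2) q(3,2)] by blast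
  with diff_ideal_funpow_deriv[OF assms(1) p(1)] q(1) show ?thesis by blast
qed

end
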